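(* Consider a balanced generalized Pólya urn with replacement matrix $R=\begin{pmatrix} a & b \\ c & d \end{pmatrix}$, started from $\alpha$ red and $\beta$ white balls, with composition $U_n$ at time $n$, and $\tau=\alpha+\beta$, $S=a+b=c+d$, $m=a-c=d-b$, $\sigma=m/S$, $v_1=\frac{S}{b+c}\begin{pmatrix} c \\ b \end{pmatrix}$, $v_2=\frac{S}{b+c}\begin{pmatrix} 1 \\ -1 \end{pmatrix}$. Assume that the urn is large, i.e. $\sigma>1/2$. Then $$\lim_{n\to\infty}\frac{U_n}{n}=v_1$$ almost surely and in $\mathbb{L}^p$ for every $p\ge1$. Moreover, there is a real-valued random variable $W$ such that $$\lim_{n\to\infty}\frac{U_n-nv_1}{n^\sigma}=W v_2$$ almost surely and in $\mathbb{L}^2$, and $$\mathbb{E}[W]=\frac{\Gamma(\frac{\tau}{S})}{\Gamma(\frac{\tau}{S}+\sigma)}\,\frac{b\alpha-c\beta}{S},$$ $$\mathbb{E}[W^2]=\sigma^2\,\frac{\Gamma(\frac{\tau}{S})}{\Gamma(\frac{\tau}{S}+2\sigma)}\left(\frac{bc}{2\sigma-1}\,\frac{\tau}{S}+(b-c)\,\frac{b\alpha-c\beta}{\sigma S}+\frac{(b\alpha-c\beta)^2}{\sigma^2S^2}\right),$$ where $\Gamma$ denotes the Euler Gamma function.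
   Context: Generalized Pólya urn model: $a,b,c,d$ are nonnegative integers, the replacement matrix $R$ is not diagonal ($b+c\ge1$), and the urn is balanced: $a+b=c+d=S\ge1$. At time $0$ the urn contains $\alpha\ge0$ red balls and $\beta\ge0$ white balls ($\alpha,\beta$ integers), with $\tau=\alpha+\beta\ge1$. At each time $n\ge1$ one ball is drawn uniformly at random from the urn and its color observed. If it is red, it is returned together with $a$ additional red balls and $b$ additional white balls; if it is white, it is returned together with $c$ additional red balls and $d$ additional white balls. $U_n=(X_n,Y_n)^T$, where $X_n$ and $Y_n$ are the numbers of red and white balls at time $n$; $U_0=(\alpha,\beta)^T$ and $X_n+Y_n=\tau_n=\tau+nS$. Equivalently, $U_{n+1}=U_n+R^T(\varepsilon_{n+1},1-\varepsilon_{n+1})^T$, where the conditional distribution of $\varepsilon_{n+1}$ given the past $\mathcal{F}_n$ up to time $n$ is Bernoulli with parameter $X_n/\tau_n$. *)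

theory Defs
  imports "HOL-Probability.Probability"
begin

definition in_Lp :: "'w measure \<Rightarrow> real \<Rightarrow> ('w \<Rightarrow> 'b::real_normed_vector) \<Rightarrow> bool" where
  "in_Lp M p f \<longleftrightarrow> f \<in> borel_measurable M \<and> integrable M (\<lambda>\<omega>. norm (f \<omega>) powr p)"

definition tendsto_Lp ::
  "'w measure \<Rightarrow> real \<Rightarrow> (nat \<Rightarrow> 'w \<Rightarrow> 'b::real_normed_vector) \<Rightarrow> ('w \<Rightarrow> 'b) \<Rightarrow> bool" where
  "tendsto_Lp M p f g \<longleftrightarrow> (\<forall>n. in_Lp M p (f n)) \<and> in_Lp M p g \<and>
     (\<lambda>n. \<integral>\<omega>. norm (f n \<omega> - g \<omega>) powr p \<partial>M) \<longlonglongrightarrow> 0"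

definition replacement_matrix :: "nat \<Rightarrow> nat \<Rightarrow> nat \<Rightarrow> nat \<Rightarrow> real^2^2" where
  "replacement_matrix a b c d = vector [vector [real a, real b], vector [real c, real d]]"

(* The sigma-algebra generated by the colours of the first n balls drawn.  As the initial
   composition is deterministic, it also makes the compositions at times 0, ..., n measurable. *)
definition past :: "'w measure \<Rightarrow> (nat \<Rightarrow> 'w \<Rightarrow> bool) \<Rightarrow> nat \<Rightarrow> 'w measure" where
  "past M red n = sigma (space M) ((\<lambda>k. {\<omega> \<in> space M. red k \<omega>}) ` {1..n})"

(* red n tells whether the ball drawn at time n is red (n >= 1; red 0 is irrelevant);
   of_bool (red n) is the Bernoulli variable that drives the urn at step n.
   U n $ 1 and U n $ 2 are the numbers of red and white balls at time n. *)
locale balanced_polya_urn = prob_space M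
  for M :: "'w measure" +
  fixes a b c d \<alpha> \<beta> :: nat
    and red :: "nat \<Rightarrow> 'w \<Rightarrow> bool"
    and U :: "nat \<Rightarrow> 'w \<Rightarrow> real^2"
  assumes not_diagonal: "b + c \<ge> 1"
    and balanced: "a + b = c + d"
    and balance_pos: "a + b \<ge> 1"
    and initially_nonempty: "\<alpha> + \<beta> \<ge> 1"
    and red_measurable: "\<And>n. n \<ge> 1 \<Longrightarrow> red n \<in> measurable M (count_space UNIV)"
    and U_0: "\<And>\<omega>. \<omega> \<in> space M \<Longrightarrow> U 0 \<omega> = vector [real \<alpha>, real \<beta>]"
    and U_Suc: "\<And>n \<omega>. \<omega> \<in> space M \<Longrightarrow>
      U (Suc n) \<omega> = U n \<omega> + transpose (replacement_matrix a b c d) *v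
        vector [of_bool (red (Suc n) \<omega>), 1 - of_bool (red (Suc n) \<omega>)]"
    and uniform_draw: "\<And>n. AE \<omega> in M.
      real_cond_exp M (past M red n) (\<lambda>\<omega>. of_bool (red (Suc n) \<omega>)) \<omega>
        = U n \<omega> $ 1 / (U n \<omega> $ 1 + U n \<omega> $ 2)"

end

theory Submission
  imports Defs "HOL-Real_Asymp.Real_Asymp"
begin

text \<open>In the eigenbasis \<open>v\<^sub>1, v\<^sub>2\<close> of the transposed replacement matrix,
  \<open>U n = (n + \<tau> / S) v\<^sub>1 + Z n v\<^sub>2\<close>, where \<open>E (Z (n + 1) | past) = (1 + \<sigma> / (n + \<tau> / S)) Z n\<close>.
  Hence \<open>Z n / \<gamma> n\<close> is a martingale for a ratio \<open>\<gamma> n\<close> of Pochhammer symbols, which is asymptotic to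
  \<open>n\<^sup>\<sigma> \<Gamma>(\<tau>/S) / \<Gamma>(\<tau>/S + \<sigma>)\<close>. The second moment of \<open>Z n\<close> satisfies a linear recursion with an explicit
  solution; for \<open>\<sigma> > 1/2\<close> it is of order \<open>n\<close> to the power \<open>2 \<sigma>\<close>, so the martingale is bounded in
  \<open>L\<^sup>2\<close> and converges almost surely and in \<open>L\<^sup>2\<close> by Kolmogorov's maximal inequality. The limit of
  \<open>U n / n\<close> follows from \<open>\<sigma> < 1\<close> and, in \<open>L\<^sup>p\<close>, from boundedness.\<close>

section \<open>Square-integrable martingales\<close>

lemma integrable_mult_square_integrable:
  fixes f g :: "'a \<Rightarrow> real"
  assumes [measurable]: "f \<in> borel_measurable M" "g \<in> borel_measurable M"
    and "integrable M (\<lambda>x. (f x)\<^sup>2)" "integrable M (\<lambda>x. (g x)\<^sup>2)"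
  shows "integrable M (\<lambda>x. f x * g x)"
proof (rule Bochner_Integration.integrable_bound)
  show "integrable M (\<lambda>x. (f x)\<^sup>2 + (g x)\<^sup>2)"
    using assms by simp
  have "\<bar>f x * g x\<bar> \<le> (f x)\<^sup>2 + (g x)\<^sup>2" for x
    using sum_squares_bound[of "\<bar>f x\<bar>" "\<bar>g x\<bar>"] abs_ge_zero[of "f x * g x"]
    unfolding abs_mult power2_abs by linarith
  then show "AE x in M. norm (f x * g x) \<le> norm ((f x)\<^sup>2 + (g x)\<^sup>2)"
    by (simp add: order.trans[OF _ abs_ge_self])
qed simp

text \<open>A weighted inequality \<open>u * v \<le> r * u\<^sup>2 + v\<^sup>2 / r\<close> stands in
  for Cauchy-Schwarz: with \<open>r\<close> close to the \<open>L2\<close> distance of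
  \<open>f n\<close> and \<open>g\<close>, the integrals differ by at most a constant multiple of
  \<open>r\<close>. It is applied with \<open>h = 1\<close> for means and with \<open>h\<close> the
  limit itself for second moments.\<close>

lemma tendsto_integral_mult_of_L2:
  fixes f :: "nat \<Rightarrow> 'a \<Rightarrow> real"
  assumes [measurable]: "\<And>n. f n \<in> borel_measurable M" "g \<in> borel_measurable M" "h \<in> borel_measurable M"
    and f: "\<And>n. integrable M (\<lambda>x. (f n x)\<^sup>2)" and g: "integrable M (\<lambda>x. (g x)\<^sup>2)"
    and h: "integrable M (\<lambda>x. (h x)\<^sup>2)" and diff: "\<And>n. integrable M (\<lambda>x. (f n x - g x)\<^sup>2)"
    and lim: "(\<lambda>n. \<integral>x. (f n x - g x)\<^sup>2 \<partial>M) \<longlonglongrightarrow> 0"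
  shows "(\<lambda>n. \<integral>x. h x * f n x \<partial>M) \<longlonglongrightarrow> (\<integral>x. h x * g x \<partial>M)"
proof -
  define e where "e n = (\<integral>x. (f n x - g x)\<^sup>2 \<partial>M)" for n
  \<comment> \<open>The summand \<open>inverse (real (Suc n))\<close> keeps \<open>r n\<close>
    positive even when \<open>e n = 0\<close>, so that dividing by \<open>r n\<close> is
    legitimate.\<close>
  define r where "r n = sqrt (e n) + inverse (real (Suc n))" for n
  let ?H = "\<integral>x. (h x)\<^sup>2 \<partial>M"
  have e_nonneg: "e n \<ge> 0" for n
    by (simp add: e_def)
  have r_pos: "r n > 0" for n
    using e_nonneg[of n] by (simp add: r_def add_nonneg_pos)
  have "r \<longlonglongrightarrow> sqrt 0 + 0"
    unfolding r_def using lim LIMSEQ_inverse_real_of_nat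
    by (intro tendsto_intros) (auto simp: e_def)
  then have "(\<lambda>n. r n * ?H + r n) \<longlonglongrightarrow> 0 * ?H + 0"
    by (intro tendsto_intros) auto
  then have lim0: "(\<lambda>n. r n * ?H + r n) \<longlonglongrightarrow> 0"
    by simp
  have bound: "\<bar>(\<integral>x. h x * f n x \<partial>M) - (\<integral>x. h x * g x \<partial>M)\<bar> \<le> r n * ?H + r n" for n
  proof -
    have int: "integrable M (\<lambda>x. h x * f n x)" "integrable M (\<lambda>x. h x * g x)"
        "integrable M (\<lambda>x. h x * (f n x - g x))"
      using f g h diff by (auto intro!: integrable_mult_square_integrable)
    have pt: "\<bar>h x * (f n x - g x)\<bar> \<le> r n * (h x)\<^sup>2 + (f n x - g x)\<^sup>2 / r n" for x
    proof -
      define u v where "u = \<bar>h x\<bar>" and "v = \<bar>f n x - g x\<bar>"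
      \<comment> \<open>The right-hand side expands to
        \<open>(r n * u)\<^sup>2 + v\<^sup>2 - r n * u * v\<close>.\<close>
      have "0 \<le> (r n * u - v)\<^sup>2 + r n * u * v"
        using r_pos[of n] by (auto simp: u_def v_def)
      then have "r n * (u * v) \<le> (r n * u)\<^sup>2 + v\<^sup>2"
        by (simp add: power2_eq_square algebra_simps)
      also have "\<dots> = r n * (r n * u\<^sup>2 + v\<^sup>2 / r n)"
        using r_pos[of n] by (simp add: field_simps power2_eq_square)
      finally have "r n * (u * v) \<le> r n * (r n * u\<^sup>2 + v\<^sup>2 / r n)" .
      then have "u * v \<le> r n * u\<^sup>2 + v\<^sup>2 / r n"
        using r_pos[of n] mult_le_cancel_left_pos by blast
      then show ?thesis
        by (simp add: u_def v_def abs_mult)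
    qed
    have "\<bar>(\<integral>x. h x * f n x \<partial>M) - (\<integral>x. h x * g x \<partial>M)\<bar> = \<bar>\<integral>x. h x * (f n x - g x) \<partial>M\<bar>"
      using int by (simp add: right_diff_distrib)
    also have "\<dots> \<le> (\<integral>x. \<bar>h x * (f n x - g x)\<bar> \<partial>M)"
      by (rule integral_abs_bound)
    also have "\<dots> \<le> (\<integral>x. r n * (h x)\<^sup>2 + (f n x - g x)\<^sup>2 / r n \<partial>M)"
      using pt int h diff by (intro integral_mono) auto
    also have "\<dots> = r n * ?H + e n / r n"
      using h diff by (simp add: e_def)
    also have "e n / r n \<le> r n"
    proof -
      have "sqrt (e n) * sqrt (e n) \<le> r n * r n"
        using e_nonneg[of n] by (intro mult_mono) (auto simp: r_def)
      then show ?thesis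
        using r_pos[of n] e_nonneg[of n] by (simp add: pos_divide_le_eq)
    qed
    finally show ?thesis by simp
  qed
  have "(\<lambda>n. (\<integral>x. h x * f n x \<partial>M) - (\<integral>x. h x * g x \<partial>M)) \<longlonglongrightarrow> 0"
    using bound by (intro Lim_null_comparison[OF always_eventually lim0] allI) (simp only: real_norm_def)
  then show ?thesis
    by (rule LIM_zero_cancel)
qed

section \<open>Orthogonality, maximal inequality and convergence for martingales\<close>

locale l2_martingale = prob_space M
  for M :: "'w measure" +
  fixes F :: "nat \<Rightarrow> 'w measure" and X :: "nat \<Rightarrow> 'w \<Rightarrow> real"
  assumes subalg: "\<And>n. subalgebra M (F n)"
    and subalg_Suc: "\<And>n. subalgebra (F (Suc n)) (F n)"
    and adapted: "\<And>n. X n \<in> borel_measurable (F n)"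
    and square_integrable: "\<And>n. integrable M (\<lambda>\<omega>. (X n \<omega>)\<^sup>2)"
    and cond_exp_Suc: "\<And>n. AE \<omega> in M. real_cond_exp M (F n) (X (Suc n)) \<omega> = X n \<omega>"
begin

lemma sets_mono: "m \<le> n \<Longrightarrow> sets (F m) \<subseteq> sets (F n)"
  by (rule lift_Suc_mono_le) (use subalg_Suc in \<open>simp_all add: subalgebra_def\<close>)

lemma subalg_mono: "m \<le> n \<Longrightarrow> subalgebra (F n) (F m)"
  using sets_mono[of m n] subalg[of m] subalg[of n] by (simp add: subalgebra_def)

lemma measurable_mono: "m \<le> n \<Longrightarrow> f \<in> borel_measurable (F m) \<Longrightarrow> f \<in> borel_measurable (F n)"
  by (rule measurable_from_subalg[OF subalg_mono])

lemma measurable_M: "f \<in> borel_measurable (F n) \<Longrightarrow> f \<in> borel_measurable M"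
  by (rule measurable_from_subalg[OF subalg])

lemma X_measurable [measurable]: "X n \<in> borel_measurable M"
  by (rule measurable_M[OF adapted])

lemma integrable_mult_X:
  assumes "f \<in> borel_measurable M" "integrable M (\<lambda>\<omega>. (f \<omega>)\<^sup>2)"
  shows "integrable M (\<lambda>\<omega>. f \<omega> * X n \<omega>)"
  by (rule integrable_mult_square_integrable[OF assms(1) X_measurable assms(2) square_integrable])

text \<open>The martingale property in weak form: \<open>f\<close> is known at time
  \<open>n\<close>, so it can be pulled out of the conditional expectation. Square integrability of
  \<open>f\<close> makes the products integrable.\<close>

lemma integral_mult_X_Suc:
  assumes f: "f \<in> borel_measurable (F n)" "integrable M (\<lambda>\<omega>. (f \<omega>)\<^sup>2)"
  shows "(\<integral>\<omega>. f \<omega> * X (Suc n) \<omega> \<partial>M) = (\<integral>\<omega>. f \<omega> * X n \<omega> \<partial>M)"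
proof -
  interpret finite_measure_subalgebra M "F n"
    by unfold_locales (rule subalg)
  have fM [measurable]: "f \<in> borel_measurable M"
    using f measurable_M by blast
  have "(\<integral>\<omega>. f \<omega> * X (Suc n) \<omega> \<partial>M) = (\<integral>\<omega>. f \<omega> * real_cond_exp M (F n) (X (Suc n)) \<omega> \<partial>M)"
    using f by (intro real_cond_exp_intg(2)[symmetric] integrable_mult_X) auto
  also have "\<dots> = (\<integral>\<omega>. f \<omega> * X n \<omega> \<partial>M)"
    using cond_exp_Suc[of n] by (intro integral_cong_AE) auto
  finally show ?thesis .
qed

lemma integral_mult_X:
  assumes "m \<le> n" and f: "f \<in> borel_measurable (F m)" "integrable M (\<lambda>\<omega>. (f \<omega>)\<^sup>2)"
  shows "(\<integral>\<omega>. f \<omega> * X n \<omega> \<partial>M) = (\<integral>\<omega>. f \<omega> * X m \<omega> \<partial>M)"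
  using \<open>m \<le> n\<close>
proof (induction n rule: dec_induct)
  case (step n)
  then show ?case
    using integral_mult_X_Suc[of f n] f measurable_mono by auto
qed simp

lemma expectation_X: "expectation (X n) = expectation (X 0)"
  using integral_mult_X[of 0 n "\<lambda>_. 1"] by simp

lemma integrable_square_diff: "integrable M (\<lambda>\<omega>. (X n \<omega> - X m \<omega>)\<^sup>2)"
proof -
  have "(\<lambda>\<omega>. (X n \<omega> - X m \<omega>)\<^sup>2) = (\<lambda>\<omega>. (X n \<omega>)\<^sup>2 + (X m \<omega>)\<^sup>2 - 2 * (X n \<omega> * X m \<omega>))"
    by (simp add: power2_diff mult.assoc)
  then show ?thesis
    using square_integrable integrable_mult_X[OF X_measurable square_integrable, of n m] by simp
qed

text \<open>Increments are orthogonal to the past: testing \<open>X n\<close> against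
  \<open>X m\<close> turns the cross term into the second moment of \<open>X m\<close>. In
  particular second moments increase with time.\<close>

lemma expectation_square_diff:
  assumes "m \<le> n"
  shows "expectation (\<lambda>\<omega>. (X n \<omega> - X m \<omega>)\<^sup>2)
    = expectation (\<lambda>\<omega>. (X n \<omega>)\<^sup>2) - expectation (\<lambda>\<omega>. (X m \<omega>)\<^sup>2)"
proof -
  have int: "integrable M (\<lambda>\<omega>. X m \<omega> * X n \<omega>)"
    by (rule integrable_mult_X[OF X_measurable square_integrable])
  have "expectation (\<lambda>\<omega>. (X n \<omega> - X m \<omega>)\<^sup>2)
      = expectation (\<lambda>\<omega>. (X n \<omega>)\<^sup>2 + (X m \<omega>)\<^sup>2 - 2 * (X m \<omega> * X n \<omega>))"
    by (simp add: power2_diff algebra_simps)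
  also have "\<dots> = expectation (\<lambda>\<omega>. (X n \<omega>)\<^sup>2) + expectation (\<lambda>\<omega>. (X m \<omega>)\<^sup>2)
      - 2 * expectation (\<lambda>\<omega>. X m \<omega> * X n \<omega>)"
    using int square_integrable by simp
  also have "expectation (\<lambda>\<omega>. X m \<omega> * X n \<omega>) = expectation (\<lambda>\<omega>. (X m \<omega>)\<^sup>2)"
    using integral_mult_X[OF assms adapted square_integrable] by (simp add: power2_eq_square)
  finally show ?thesis
    by simp
qed

text \<open>Kolmogorov's inequality for the increments after time \<open>m\<close>. The stopped
  process keeps its exit value, so a single Markov bound at the final time \<open>N\<close> controls
  the whole range of times.\<close>

lemma maximal_inequality:
  assumes "m \<le> N" "\<epsilon> > 0"
  shows "prob {\<omega> \<in> space M. \<exists>n\<in>{m..N}. \<epsilon> \<le> \<bar>X n \<omega> - X m \<omega>\<bar>}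
    \<le> (expectation (\<lambda>\<omega>. (X N \<omega>)\<^sup>2) - expectation (\<lambda>\<omega>. (X m \<omega>)\<^sup>2)) / \<epsilon>\<^sup>2"
proof -
  define H :: "nat \<Rightarrow> 'w \<Rightarrow> real"
    where "H n \<omega> = of_bool (\<forall>i\<in>{m..n}. \<bar>X i \<omega> - X m \<omega>\<bar> < \<epsilon>)" for n \<omega>
  \<comment> \<open>\<open>X - X m\<close>, stopped when it first reaches distance \<open>\<epsilon>\<close> from 0\<close>
  define V where "V n \<omega> = (\<Sum>j\<in>{m..<n}. H j \<omega> * (X (Suc j) \<omega> - X j \<omega>))" for n \<omega>
  have V_Suc: "V (Suc n) \<omega> = V n \<omega> + H n \<omega> * (X (Suc n) \<omega> - X n \<omega>)" if "m \<le> n" for n \<omega>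
    using that by (simp add: V_def)
  have H_meas: "H n \<in> borel_measurable (F n)" if "m \<le> n" for n
  proof -
    have [measurable]: "i \<in> {m..n} \<Longrightarrow> X i \<in> borel_measurable (F n)" for i
      using measurable_mono adapted by auto
    have [measurable]: "X m \<in> borel_measurable (F n)"
      using measurable_mono adapted that by auto
    show ?thesis
      unfolding H_def by measurable
  qed
  have V_meas: "V n \<in> borel_measurable (F n)" for n
    unfolding V_def
  proof (intro borel_measurable_sum borel_measurable_times borel_measurable_diff)
    fix j assume "j \<in> {m..<n}"
    then show "H j \<in> borel_measurable (F n)" "X (Suc j) \<in> borel_measurable (F n)"
        "X j \<in> borel_measurable (F n)"
      using measurable_mono[of j n] measurable_mono[of "Suc j" n] H_meas adapted by auto
  qed
  have H_M: "H n \<in> borel_measurable M" if "m \<le> n" for n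
    using that H_meas measurable_M by blast
  have V_M [measurable]: "V n \<in> borel_measurable M" for n
    using V_meas measurable_M by blast
  \<comment> \<open>Since \<open>V n * H n\<close> is known at time \<open>n\<close>, the cross term
    in the square of \<open>V (Suc n)\<close> has mean zero; since \<open>H n\<close> is 0 or 1,
    stopping can only shrink the squared increments.\<close>
  have V_bound: "integrable M (\<lambda>\<omega>. (V n \<omega>)\<^sup>2)
      \<and> expectation (\<lambda>\<omega>. (V n \<omega>)\<^sup>2) \<le> expectation (\<lambda>\<omega>. (X n \<omega>)\<^sup>2) - expectation (\<lambda>\<omega>. (X m \<omega>)\<^sup>2)"
    if "m \<le> n" for n
    using that
  proof (induction n rule: dec_induct)
    case base
    then show ?case by (simp add: V_def)
  next
    case (step n)
    let ?D = "\<lambda>\<omega>. X (Suc n) \<omega> - X n \<omega>"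
    note [measurable] = H_M[OF step(1)]
    have D2: "integrable M (\<lambda>\<omega>. (?D \<omega>)\<^sup>2)"
      by (rule integrable_square_diff)
    have VH2: "integrable M (\<lambda>\<omega>. (V n \<omega> * H n \<omega>)\<^sup>2)"
      by (rule Bochner_Integration.integrable_bound[OF conjunct1[OF step.IH]])
         (auto simp: H_def)
    have VHX: "integrable M (\<lambda>\<omega>. V n \<omega> * H n \<omega> * X i \<omega>)" for i
      using VH2 by (intro integrable_mult_X) auto
    have HD2: "integrable M (\<lambda>\<omega>. H n \<omega> * (?D \<omega>)\<^sup>2)"
      by (rule Bochner_Integration.integrable_bound[OF D2]) (auto simp: H_def)
    have eq: "(V (Suc n) \<omega>)\<^sup>2 = (V n \<omega>)\<^sup>2 + 2 * (V n \<omega> * H n \<omega> * X (Suc n) \<omega> - V n \<omega> * H n \<omega> * X n \<omega>)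
        + H n \<omega> * (?D \<omega>)\<^sup>2" for \<omega>
    proof -
      have "(H n \<omega>)\<^sup>2 = H n \<omega>" by (simp add: H_def)
      then show ?thesis
        unfolding V_Suc[OF step(1)] power2_sum power_mult_distrib by (simp add: algebra_simps)
    qed
    have zero: "expectation (\<lambda>\<omega>. V n \<omega> * H n \<omega> * X (Suc n) \<omega>)
        = expectation (\<lambda>\<omega>. V n \<omega> * H n \<omega> * X n \<omega>)"
      using VH2 V_meas[of n] H_meas[OF step(1)] by (intro integral_mult_X_Suc) auto
    have "expectation (\<lambda>\<omega>. (V (Suc n) \<omega>)\<^sup>2)
        = expectation (\<lambda>\<omega>. (V n \<omega>)\<^sup>2) + expectation (\<lambda>\<omega>. H n \<omega> * (?D \<omega>)\<^sup>2)"
      unfolding eq using VHX HD2 step.IH zero by simp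
    also have "expectation (\<lambda>\<omega>. H n \<omega> * (?D \<omega>)\<^sup>2) \<le> expectation (\<lambda>\<omega>. (?D \<omega>)\<^sup>2)"
      using HD2 D2 by (intro integral_mono) (auto simp: H_def)
    also have "\<dots> = expectation (\<lambda>\<omega>. (X (Suc n) \<omega>)\<^sup>2) - expectation (\<lambda>\<omega>. (X n \<omega>)\<^sup>2)"
      by (rule expectation_square_diff) simp
    finally have "expectation (\<lambda>\<omega>. (V (Suc n) \<omega>)\<^sup>2)
        \<le> expectation (\<lambda>\<omega>. (X (Suc n) \<omega>)\<^sup>2) - expectation (\<lambda>\<omega>. (X m \<omega>)\<^sup>2)"
      using step.IH by linarith
    moreover have "integrable M (\<lambda>\<omega>. (V (Suc n) \<omega>)\<^sup>2)"
      unfolding eq using VHX HD2 step.IH by simp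
    ultimately show ?case by blast
  qed
  have V_eq: "V (Suc n) \<omega> = X (Suc n) \<omega> - X m \<omega>"
    if "m \<le> n" "\<forall>i\<in>{m..n}. \<bar>X i \<omega> - X m \<omega>\<bar> < \<epsilon>" for n \<omega>
  proof -
    have "V (Suc n) \<omega> = (\<Sum>j\<in>{m..<Suc n}. X (Suc j) \<omega> - X j \<omega>)"
      unfolding V_def by (rule sum.cong) (use that in \<open>auto simp: H_def\<close>)
    also have "\<dots> = X (Suc n) \<omega> - X m \<omega>"
      using that by (intro sum_Suc_diff') simp
    finally show ?thesis .
  qed
  \<comment> \<open>After an exit \<open>H\<close> vanishes and \<open>V\<close> is frozen. If the
    first exit happens at \<open>Suc n\<close>, all earlier factors \<open>H\<close> are 1 and the
    sum telescopes by \<open>V_eq\<close>.\<close>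
  have exit: "\<epsilon> \<le> \<bar>V n \<omega>\<bar>" if "m \<le> n" "\<exists>i\<in>{m..n}. \<epsilon> \<le> \<bar>X i \<omega> - X m \<omega>\<bar>" for n \<omega>
    using that
  proof (induction n rule: dec_induct)
    case base
    then show ?case using \<open>\<epsilon> > 0\<close> by simp
  next
    case (step n)
    show ?case
    proof (cases "\<exists>i\<in>{m..n}. \<epsilon> \<le> \<bar>X i \<omega> - X m \<omega>\<bar>")
      case True
      then have "H n \<omega> = 0"
        by (auto simp: H_def not_less)
      then show ?thesis
        using V_Suc[OF step(1)] step.IH True by simp
    next
      case False
      then show ?thesis
        using step.prems V_eq[OF step(1), of \<omega>] by (simp add: not_le atLeastAtMostSuc_conv step(1) le_Suc_eq)
          (metis linorder_not_le)
    qed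
  qed
  have "prob {\<omega> \<in> space M. \<exists>n\<in>{m..N}. \<epsilon> \<le> \<bar>X n \<omega> - X m \<omega>\<bar>}
      \<le> prob {\<omega> \<in> space M. \<epsilon>\<^sup>2 \<le> (V N \<omega>)\<^sup>2}"
  proof (rule finite_measure_mono)
    have "\<epsilon>\<^sup>2 \<le> (V N \<omega>)\<^sup>2" if "\<exists>n\<in>{m..N}. \<epsilon> \<le> \<bar>X n \<omega> - X m \<omega>\<bar>" for \<omega>
      using exit[OF assms(1) that] \<open>\<epsilon> > 0\<close> abs_le_square_iff[of \<epsilon> "V N \<omega>"] by simp
    then show "{\<omega> \<in> space M. \<exists>n\<in>{m..N}. \<epsilon> \<le> \<bar>X n \<omega> - X m \<omega>\<bar>} \<subseteq> {\<omega> \<in> space M. \<epsilon>\<^sup>2 \<le> (V N \<omega>)\<^sup>2}"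
      by blast
  qed measurable
  also have "\<dots> \<le> expectation (\<lambda>\<omega>. (V N \<omega>)\<^sup>2) / \<epsilon>\<^sup>2"
    using V_bound[OF assms(1)] \<open>\<epsilon> > 0\<close>
    by (intro integral_Markov_inequality_measure[where A = "space M"]) auto
  also have "\<dots> \<le> (expectation (\<lambda>\<omega>. (X N \<omega>)\<^sup>2) - expectation (\<lambda>\<omega>. (X m \<omega>)\<^sup>2)) / \<epsilon>\<^sup>2"
    using V_bound[OF assms(1)] by (intro divide_right_mono) auto
  finally show ?thesis .
qed

text \<open>The maximal inequality makes almost every path Cauchy, and Fatou's lemma gives
  convergence in \<open>L2\<close>. The first two moments of the limit then follow by passing to the
  limit under the integral.\<close>

theorem convergence:
  assumes "(\<lambda>n. expectation (\<lambda>\<omega>. (X n \<omega>)\<^sup>2)) \<longlonglongrightarrow> L"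
  obtains X' where "X' \<in> borel_measurable M" "AE \<omega> in M. (\<lambda>n. X n \<omega>) \<longlonglongrightarrow> X' \<omega>"
    "\<And>n. integrable M (\<lambda>\<omega>. (X n \<omega> - X' \<omega>)\<^sup>2)" "integrable M (\<lambda>\<omega>. (X' \<omega>)\<^sup>2)"
    "(\<lambda>n. expectation (\<lambda>\<omega>. (X n \<omega> - X' \<omega>)\<^sup>2)) \<longlonglongrightarrow> 0"
    "expectation X' = expectation (X 0)" "expectation (\<lambda>\<omega>. (X' \<omega>)\<^sup>2) = L"
proof -
  let ?s = "\<lambda>n. expectation (\<lambda>\<omega>. (X n \<omega>)\<^sup>2)"
  have mono: "?s m \<le> ?s n" if "m \<le> n" for m n
  proof -
    have "0 \<le> expectation (\<lambda>\<omega>. (X n \<omega> - X m \<omega>)\<^sup>2)"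
      by simp
    then show ?thesis
      using expectation_square_diff[OF that] by simp
  qed
  have le_L: "?s n \<le> L" for n
    by (rule incseq_le[OF _ assms]) (simp add: incseq_def mono)
  define B where "B m \<epsilon> N = {\<omega> \<in> space M. \<exists>n\<in>{m..N}. \<epsilon> \<le> \<bar>X n \<omega> - X m \<omega>\<bar>}" for m N :: nat and \<epsilon> :: real
  have B_sets [measurable]: "B m \<epsilon> N \<in> sets M" for m \<epsilon> N
    unfolding B_def by measurable
  \<comment> \<open>Continuity from below lets the horizon \<open>N\<close> tend to infinity in the
    maximal inequality.\<close>
  have Un: "prob (\<Union>N. B m \<epsilon> N) \<le> (L - ?s m) / \<epsilon>\<^sup>2" if "\<epsilon> > 0" for m \<epsilon>
  proof (rule LIMSEQ_le_const2)
    show "(\<lambda>N. prob (B m \<epsilon> N)) \<longlonglongrightarrow> prob (\<Union>N. B m \<epsilon> N)"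
      by (rule finite_Lim_measure_incseq) (auto simp: B_def incseq_def intro: order.trans)
    have "prob (B m \<epsilon> N) \<le> (L - ?s m) / \<epsilon>\<^sup>2" if "m \<le> N" for N
      unfolding B_def
      by (rule order.trans[OF maximal_inequality[OF \<open>m \<le> N\<close> \<open>\<epsilon> > 0\<close>]])
         (simp add: divide_right_mono le_L)
    then show "\<exists>N. \<forall>n\<ge>N. prob (B m \<epsilon> n) \<le> (L - ?s m) / \<epsilon>\<^sup>2"
      by blast
  qed
  \<comment> \<open>A path violating the claim lies in the union over \<open>N\<close> for every
    starting time \<open>m\<close>, and the bound on the probability of these unions tends to 0
    because \<open>?s m\<close> tends to \<open>L\<close>.\<close>
  have null: "AE \<omega> in M. \<exists>m. \<forall>n\<ge>m. \<bar>X n \<omega> - X m \<omega>\<bar> < \<epsilon>" if "\<epsilon> > 0" for \<epsilon>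
  proof -
    let ?C = "\<Inter>m. \<Union>N. B m \<epsilon> N"
    have "prob ?C \<le> (L - ?s m) / \<epsilon>\<^sup>2" for m
      by (rule order.trans[OF finite_measure_mono Un[OF that]]) auto
    moreover have "(\<lambda>m. (L - ?s m) / \<epsilon>\<^sup>2) \<longlonglongrightarrow> (L - L) / \<epsilon>\<^sup>2"
      using that by (intro tendsto_intros assms) simp
    ultimately have "prob ?C \<le> (L - L) / \<epsilon>\<^sup>2"
      by (intro LIMSEQ_le_const) auto
    then have "prob ?C = 0"
      by (simp add: measure_le_0_iff)
    then have "AE \<omega> in M. \<omega> \<notin> ?C"
      by (subst AE_iff_measurable[where N = ?C]) (auto simp: B_def emeasure_eq_measure)
    with AE_space show ?thesis
    proof eventually_elim
      case (elim \<omega>)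
      then obtain m where m: "\<omega> \<notin> B m \<epsilon> N" for N
        by auto
      have "\<bar>X n \<omega> - X m \<omega>\<bar> < \<epsilon>" if "n \<ge> m" for n
        using elim(1) that m[of n] by (auto simp: B_def not_le)
      then show ?case by blast
    qed
  qed
  have "AE \<omega> in M. \<forall>k. \<exists>m. \<forall>n\<ge>m. \<bar>X n \<omega> - X m \<omega>\<bar> < inverse (real (Suc k))"
    unfolding AE_all_countable using null by simp
  then have conv: "AE \<omega> in M. convergent (\<lambda>n. X n \<omega>)"
  proof eventually_elim
    case (elim \<omega>)
    have "Cauchy (\<lambda>n. X n \<omega>)"
    proof (rule CauchyI')
      fix e :: real assume "e > 0"
      then obtain k where k: "inverse (real (Suc k)) < e / 2"
        using reals_Archimedean[of "e / 2"] by auto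
      from elim obtain m where m: "\<forall>n\<ge>m. \<bar>X n \<omega> - X m \<omega>\<bar> < inverse (real (Suc k))"
        by blast
      have "dist (X i \<omega>) (X j \<omega>) < e" if "i \<ge> m" "j > i" for i j
        using m[rule_format, of i] m[rule_format, of j] k that
        unfolding dist_real_def by linarith
      then show "\<exists>M. \<forall>m\<ge>M. \<forall>n>m. dist (X m \<omega>) (X n \<omega>) < e"
        by blast
    qed
    then show ?case by (simp add: Cauchy_convergent_iff)
  qed
  \<comment> \<open>Where a path diverges, \<open>lim\<close> yields an unspecified value. This
    concerns only a null set, and \<open>X'\<close> is still measurable.\<close>
  define X' where "X' \<omega> = lim (\<lambda>n. X n \<omega>)" for \<omega>
  have X'_meas [measurable]: "X' \<in> borel_measurable M"
    unfolding X'_def by measurable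
  have ae: "AE \<omega> in M. (\<lambda>n. X n \<omega>) \<longlonglongrightarrow> X' \<omega>"
    using conv by eventually_elim (simp add: X'_def convergent_LIMSEQ_iff)
  \<comment> \<open>Fatou's lemma, stated with nonnegative integrals because integrability of the
    squared distance to \<open>X'\<close> is itself deduced from this bound.\<close>
  have nn: "(\<integral>\<^sup>+\<omega>. ennreal ((X m \<omega> - X' \<omega>)\<^sup>2) \<partial>M) \<le> ennreal (L - ?s m)" for m
  proof -
    have "(\<integral>\<^sup>+\<omega>. ennreal ((X m \<omega> - X' \<omega>)\<^sup>2) \<partial>M)
        = (\<integral>\<^sup>+\<omega>. liminf (\<lambda>n. ennreal ((X m \<omega> - X n \<omega>)\<^sup>2)) \<partial>M)"
      using ae
      by (intro nn_integral_cong_AE, eventually_elim)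
         (intro lim_imp_Liminf[symmetric] trivial_limit_sequentially tendsto_intros)
    also have "\<dots> \<le> liminf (\<lambda>n. \<integral>\<^sup>+\<omega>. ennreal ((X m \<omega> - X n \<omega>)\<^sup>2) \<partial>M)"
      by (rule nn_integral_liminf) simp
    also have "\<dots> \<le> liminf (\<lambda>n. ennreal (L - ?s m))"
    proof (rule Liminf_mono)
      have "(\<integral>\<^sup>+\<omega>. ennreal ((X m \<omega> - X n \<omega>)\<^sup>2) \<partial>M) \<le> ennreal (L - ?s m)" if "m \<le> n" for n
      proof -
        have "(\<integral>\<^sup>+\<omega>. ennreal ((X m \<omega> - X n \<omega>)\<^sup>2) \<partial>M) = ennreal (?s n - ?s m)"
          using integrable_square_diff expectation_square_diff[OF that]
          by (subst nn_integral_eq_integral) (auto simp: power2_commute)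
        then show ?thesis
          using le_L by (simp add: ennreal_leI)
      qed
      then show "\<forall>\<^sub>F n in sequentially. (\<integral>\<^sup>+\<omega>. ennreal ((X m \<omega> - X n \<omega>)\<^sup>2) \<partial>M) \<le> ennreal (L - ?s m)"
        unfolding eventually_sequentially by blast
    qed
    finally show ?thesis
      by (simp add: Liminf_const)
  qed
  have int: "integrable M (\<lambda>\<omega>. (X m \<omega> - X' \<omega>)\<^sup>2)" for m
    using nn[of m] by (intro integrableI_nonneg) (auto intro: le_less_trans)
  have bound: "expectation (\<lambda>\<omega>. (X m \<omega> - X' \<omega>)\<^sup>2) \<le> L - ?s m" for m
    using nn[of m] le_L[of m] int by (subst (asm) nn_integral_eq_integral) auto
  have lim: "(\<lambda>m. expectation (\<lambda>\<omega>. (X m \<omega> - X' \<omega>)\<^sup>2)) \<longlonglongrightarrow> 0"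
  proof (rule Lim_null_comparison[OF always_eventually])
    have "(\<lambda>m. L - ?s m) \<longlonglongrightarrow> L - L"
      by (intro tendsto_intros assms)
    then show "(\<lambda>m. L - ?s m) \<longlonglongrightarrow> 0" by simp
  qed (use bound in simp)
  have int': "integrable M (\<lambda>\<omega>. (X' \<omega>)\<^sup>2)"
  proof (rule Bochner_Integration.integrable_bound)
    show "integrable M (\<lambda>\<omega>. 2 * (X 0 \<omega> - X' \<omega>)\<^sup>2 + 2 * (X 0 \<omega>)\<^sup>2)"
      using int square_integrable by simp
    \<comment> \<open>The right side minus the left side is the square of
      \<open>2 * X 0 \<omega> - X' \<omega>\<close>.\<close>
    have "(X' \<omega>)\<^sup>2 \<le> 2 * (X 0 \<omega> - X' \<omega>)\<^sup>2 + 2 * (X 0 \<omega>)\<^sup>2" for \<omega>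
      using zero_le_power2[of "2 * X 0 \<omega> - X' \<omega>"] by (simp add: power2_eq_square algebra_simps)
    then show "AE \<omega> in M. norm ((X' \<omega>)\<^sup>2) \<le> norm (2 * (X 0 \<omega> - X' \<omega>)\<^sup>2 + 2 * (X 0 \<omega>)\<^sup>2)"
      by simp
  qed simp
  have "(\<lambda>n. expectation (\<lambda>\<omega>. 1 * X n \<omega>)) \<longlonglongrightarrow> expectation (\<lambda>\<omega>. 1 * X' \<omega>)"
    using square_integrable int int' lim by (intro tendsto_integral_mult_of_L2) auto
  then have "(\<lambda>n. expectation (X n)) \<longlonglongrightarrow> expectation X'"
    by simp
  moreover have "(\<lambda>n. expectation (X n)) = (\<lambda>_. expectation (X 0))"
    using expectation_X by blast
  ultimately have mean: "expectation X' = expectation (X 0)"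
    by (metis LIMSEQ_unique tendsto_const)
  \<comment> \<open>The sequence is \<open>?s n\<close>, expanded around \<open>X'\<close>. Its
    limit is therefore both \<open>L\<close> and the second moment of \<open>X'\<close>.\<close>
  have "(\<lambda>n. 2 * expectation (\<lambda>\<omega>. X' \<omega> * X n \<omega>) - expectation (\<lambda>\<omega>. (X' \<omega>)\<^sup>2)
        + expectation (\<lambda>\<omega>. (X n \<omega> - X' \<omega>)\<^sup>2))
      \<longlonglongrightarrow> 2 * expectation (\<lambda>\<omega>. X' \<omega> * X' \<omega>) - expectation (\<lambda>\<omega>. (X' \<omega>)\<^sup>2) + 0"
    using square_integrable int int' lim by (intro tendsto_intros tendsto_integral_mult_of_L2) auto
  also have "(\<lambda>n. 2 * expectation (\<lambda>\<omega>. X' \<omega> * X n \<omega>) - expectation (\<lambda>\<omega>. (X' \<omega>)\<^sup>2)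
        + expectation (\<lambda>\<omega>. (X n \<omega> - X' \<omega>)\<^sup>2)) = ?s"
  proof
    fix n
    have "(\<lambda>\<omega>. (X n \<omega>)\<^sup>2) = (\<lambda>\<omega>. 2 * (X' \<omega> * X n \<omega>) - (X' \<omega>)\<^sup>2 + (X n \<omega> - X' \<omega>)\<^sup>2)"
      by (simp add: power2_eq_square algebra_simps)
    then show "2 * expectation (\<lambda>\<omega>. X' \<omega> * X n \<omega>) - expectation (\<lambda>\<omega>. (X' \<omega>)\<^sup>2)
        + expectation (\<lambda>\<omega>. (X n \<omega> - X' \<omega>)\<^sup>2) = ?s n"
      using int int' integrable_mult_X[OF X'_meas int', of n] by simp
  qed
  finally have "?s \<longlonglongrightarrow> expectation (\<lambda>\<omega>. (X' \<omega>)\<^sup>2)"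
    by (simp add: power2_eq_square)
  then have second: "expectation (\<lambda>\<omega>. (X' \<omega>)\<^sup>2) = L"
    using assms LIMSEQ_unique by blast
  show thesis
    using that X'_meas ae int int' lim mean second by blast
qed

end

section \<open>Large urns\<close>

text \<open>For positive \<open>t\<close> this is the product of
  \<open>1 + \<kappa> / (j + t)\<close> over \<open>j < n\<close>. The mean of \<open>Z n\<close>
  grows with \<open>\<kappa> = \<sigma>\<close>, the leading part of its second moment with
  \<open>\<kappa> = 2 * \<sigma>\<close>.\<close>

definition growth :: "real \<Rightarrow> real \<Rightarrow> nat \<Rightarrow> real" where
  "growth t \<kappa> n = pochhammer (t + \<kappa>) n / pochhammer t n"

lemma growth_0 [simp]: "growth t \<kappa> 0 = 1"
  by (simp add: growth_def)

lemma growth_Suc: "growth t \<kappa> (Suc n) = growth t \<kappa> n * ((real n + t + \<kappa>) / (real n + t))"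
  by (simp add: growth_def pochhammer_Suc add_ac)

lemma growth_pos:
  assumes "t > 0" "\<kappa> > 0"
  shows "growth t \<kappa> n > 0"
  using assms by (simp add: growth_def pochhammer_pos)

text \<open>\<open>Gamma_series' z n\<close> has \<open>pochhammer z n\<close> in its denominator
  and tends to \<open>Gamma z\<close>. In the quotient of the series at \<open>t\<close> and at
  \<open>t + \<kappa>\<close> the factorials cancel and \<open>1 / n powr \<kappa>\<close>
  remains.\<close>

lemma growth_asymptotics:
  assumes "t > 0" "\<kappa> > 0"
  shows "(\<lambda>n. growth t \<kappa> n / real n powr \<kappa>) \<longlonglongrightarrow> Gamma t / Gamma (t + \<kappa>)"
proof -
  have "t + \<kappa> \<notin> \<int>\<^sub>\<le>\<^sub>0"
    using assms by (auto elim!: nonpos_Ints_cases)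
  then have "Gamma (t + \<kappa>) \<noteq> 0"
    by (simp add: Gamma_eq_zero_iff)
  then have "(\<lambda>n. Gamma_series' t n / Gamma_series' (t + \<kappa>) n) \<longlonglongrightarrow> Gamma t / Gamma (t + \<kappa>)"
    by (intro tendsto_intros Gamma_series'_LIMSEQ)
  moreover have "\<forall>\<^sub>F n in sequentially.
      Gamma_series' t n / Gamma_series' (t + \<kappa>) n = growth t \<kappa> n / real n powr \<kappa>"
    using eventually_gt_at_top[of 0]
  proof eventually_elim
    case (elim n)
    have "pochhammer t n > 0" "pochhammer (t + \<kappa>) n > 0"
      using assms by (auto intro: pochhammer_pos)
    moreover have "exp ((t + \<kappa>) * ln (real n)) = exp (t * ln (real n)) * real n powr \<kappa>"
      using elim by (simp add: powr_def exp_add[symmetric] algebra_simps)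
    ultimately show ?case
      using elim by (simp add: Gamma_series'_def growth_def field_simps)
  qed
  ultimately show ?thesis
    by (rule Lim_transform_eventually)
qed

section \<open>Urn dynamics in eigencoordinates\<close>

context balanced_polya_urn
begin

text \<open>\<open>v\<^sub>1\<close> and \<open>v\<^sub>2\<close> are eigenvectors of the transposed replacement matrix for the eigenvalues \<open>S\<close>
  and \<open>S * \<sigma>\<close>; \<open>Z n\<close> is the \<open>v\<^sub>2\<close>-coordinate of \<open>U n\<close>.\<close>

definition S :: real where "S = real a + real b"
definition t :: real where "t = real (\<alpha> + \<beta>) / S"
definition \<sigma> :: real where "\<sigma> = (real a - real c) / S"
definition z\<^sub>0 :: real where "z\<^sub>0 = (real b * real \<alpha> - real c * real \<beta>) / S"

definition v\<^sub>1 :: "real^2" where "v\<^sub>1 = (S / (real b + real c)) *\<^sub>R vector [real c, real b]"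
definition v\<^sub>2 :: "real^2" where "v\<^sub>2 = (S / (real b + real c)) *\<^sub>R vector [1, -1]"

definition Z :: "nat \<Rightarrow> 'w \<Rightarrow> real" where
  "Z n \<omega> = (real b * U n \<omega> $ 1 - real c * U n \<omega> $ 2) / S"

definition drawn_red :: "nat \<Rightarrow> 'w \<Rightarrow> real" where
  "drawn_red n \<omega> = of_bool (red n \<omega>)"

lemma S_pos: "S > 0"
  using balance_pos by (simp add: S_def)

lemma t_pos: "t > 0"
  using S_pos initially_nonempty by (simp add: t_def)

lemma bc_pos: "real b + real c > 0"
  using not_diagonal by linarith

lemma balanced_real: "real a + real b = real c + real d"
  using balanced by (metis of_nat_add)

text \<open>\<open>1 - \<sigma> = (b + c) / S\<close>, which is positive because the replacement
  matrix is not diagonal.\<close>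

lemma \<sigma>_less_1: "\<sigma> < 1"
  using bc_pos S_pos by (simp add: \<sigma>_def S_def)

lemma U_Suc_components:
  assumes "\<omega> \<in> space M"
  shows "U (Suc n) \<omega> $ 1 = U n \<omega> $ 1 + real a * drawn_red (Suc n) \<omega> + real c * (1 - drawn_red (Suc n) \<omega>)"
    and "U (Suc n) \<omega> $ 2 = U n \<omega> $ 2 + real b * drawn_red (Suc n) \<omega> + real d * (1 - drawn_red (Suc n) \<omega>)"
  using assms
  by (simp_all add: U_Suc drawn_red_def replacement_matrix_def matrix_vector_mult_def transpose_def sum_2)

lemma total:
  assumes "\<omega> \<in> space M"
  shows "U n \<omega> $ 1 + U n \<omega> $ 2 = S * (real n + t)"
proof (induction n)
  case 0
  then show ?case
    using assms S_pos by (simp add: U_0 t_def)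
next
  case (Suc n)
  have "U (Suc n) \<omega> $ 1 + U (Suc n) \<omega> $ 2 = U n \<omega> $ 1 + U n \<omega> $ 2 + (real a + real b) * drawn_red (Suc n) \<omega>
      + (real c + real d) * (1 - drawn_red (Suc n) \<omega>)"
    by (simp add: U_Suc_components[OF assms] algebra_simps)
  also have "\<dots> = U n \<omega> $ 1 + U n \<omega> $ 2 + S"
    by (simp add: balanced_real[symmetric] S_def algebra_simps)
  finally show ?case
    using Suc by (simp add: algebra_simps)
qed

lemma Z_0: "\<omega> \<in> space M \<Longrightarrow> Z 0 \<omega> = z\<^sub>0"
  by (simp add: Z_def U_0 z\<^sub>0_def)

text \<open>A red draw moves \<open>Z\<close> by \<open>\<sigma> * b\<close> and a white one by
  \<open>- \<sigma> * c\<close>, whatever the composition: balance gives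
  \<open>b - d = c - a\<close>, so both increments carry the factor \<open>a - c\<close>.\<close>

lemma Z_Suc:
  assumes "\<omega> \<in> space M"
  shows "Z (Suc n) \<omega> = Z n \<omega> - \<sigma> * real c + \<sigma> * (real b + real c) * drawn_red (Suc n) \<omega>"
proof -
  have d: "real d = real a + real b - real c"
    using balanced_real by simp
  have \<sigma>S: "\<sigma> * S = real a - real c"
    using S_pos by (simp add: \<sigma>_def)
  have "Z (Suc n) \<omega> = (real b * U n \<omega> $ 1 - real c * U n \<omega> $ 2
      - (\<sigma> * S) * real c + (\<sigma> * S) * ((real b + real c) * drawn_red (Suc n) \<omega>)) / S"
    unfolding \<sigma>S Z_def U_Suc_components[OF assms] d by (simp add: algebra_simps)
  then show ?thesis
    using S_pos by (simp add: Z_def add_divide_distrib diff_divide_distrib)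
qed

text \<open>The total and \<open>Z n\<close> are two linear forms in the components of
  \<open>U n\<close>, and the system is inverted using \<open>b + c > 0\<close>. As the total is
  deterministic, all randomness of \<open>U n\<close> sits in \<open>Z n\<close>.\<close>

lemma U_eq:
  assumes "\<omega> \<in> space M"
  shows "U n \<omega> = (real n + t) *\<^sub>R v\<^sub>1 + Z n \<omega> *\<^sub>R v\<^sub>2"
proof -
  have "S * Z n \<omega> = real b * U n \<omega> $ 1 - real c * U n \<omega> $ 2"
    using S_pos by (simp add: Z_def)
  then have "S * (real n + t) * real c + S * Z n \<omega> = (real b + real c) * U n \<omega> $ 1"
    "S * (real n + t) * real b - S * Z n \<omega> = (real b + real c) * U n \<omega> $ 2"
    by (simp_all only: total[OF assms, symmetric]) (simp_all add: algebra_simps)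
  then have "U n \<omega> $ 1 = (S * (real n + t) * real c + S * Z n \<omega>) / (real b + real c)"
    "U n \<omega> $ 2 = (S * (real n + t) * real b - S * Z n \<omega>) / (real b + real c)"
    using bc_pos by simp_all
  then show ?thesis
    by (simp add: vec_eq_iff forall_2 v\<^sub>1_def v\<^sub>2_def add_divide_distrib diff_divide_distrib mult_ac)
qed

text \<open>The probability of drawing red is affine in \<open>Z n\<close>; this is what makes the
  moment recursions close.\<close>

lemma red_share_eq:
  assumes "\<omega> \<in> space M"
  shows "U n \<omega> $ 1 / (U n \<omega> $ 1 + U n \<omega> $ 2) = (real c + Z n \<omega> / (real n + t)) / (real b + real c)"
proof -
  define p N where "p = real b + real c" and "N = real n + t"
  have pos: "p > 0" "N > 0"
    using bc_pos t_pos by (simp_all add: p_def N_def)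
  have "U n \<omega> $ 1 = S * (N * real c + Z n \<omega>) / p"
    unfolding U_eq[OF assms] v\<^sub>1_def v\<^sub>2_def p_def[symmetric] N_def[symmetric] by (simp add: add_divide_distrib algebra_simps)
  then show ?thesis
    unfolding total[OF assms] p_def[symmetric] N_def[symmetric]
    using pos S_pos by (simp add: field_simps)
qed

section \<open>Adaptedness and integrability of \<open>Z\<close>\<close>

lemma space_past [simp]: "space (past M red n) = space M"
  by (simp add: past_def space_measure_of_conv)

lemma sets_past:
  "sets (past M red n) = sigma_sets (space M) ((\<lambda>k. {\<omega> \<in> space M. red k \<omega>}) ` {1..n})"
  unfolding past_def by (rule sets_measure_of) auto

lemma red_sets: "n \<ge> 1 \<Longrightarrow> {\<omega> \<in> space M. red n \<omega>} \<in> sets M"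
  using red_measurable by (auto intro: measurable_sets_Collect simp: pred_def)

lemma subalgebra_past: "subalgebra M (past M red n)"
  using red_sets by (auto simp: subalgebra_def sets_past intro!: sets.sigma_sets_subset)

lemma subalgebra_past_Suc: "subalgebra (past M red (Suc n)) (past M red n)"
  by (auto simp: subalgebra_def sets_past intro!: sigma_sets_mono')

lemma drawn_red_past: "drawn_red (Suc n) \<in> borel_measurable (past M red (Suc n))"
proof -
  have "{\<omega> \<in> space M. red (Suc n) \<omega>} \<in> sets (past M red (Suc n))"
    by (auto simp: sets_past intro!: sigma_sets.Basic)
  then have "Measurable.pred (past M red (Suc n)) (red (Suc n))"
    by (simp add: pred_def)
  then show ?thesis
    unfolding drawn_red_def by measurable
qed

lemma drawn_red_measurable [measurable]: "drawn_red (Suc n) \<in> borel_measurable M"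
  by (rule measurable_from_subalg[OF subalgebra_past drawn_red_past])

lemma Z_past: "Z n \<in> borel_measurable (past M red n)"
proof (induction n)
  case 0
  have "(\<lambda>_. z\<^sub>0) \<in> borel_measurable (past M red 0)" by simp
  then show ?case
    by (subst measurable_cong[where g = "\<lambda>_. z\<^sub>0"]) (simp_all add: Z_0)
next
  case (Suc n)
  have [measurable]: "Z n \<in> borel_measurable (past M red (Suc n))"
    by (rule measurable_from_subalg[OF subalgebra_past_Suc Suc])
  note [measurable] = drawn_red_past
  have "(\<lambda>\<omega>. Z n \<omega> - \<sigma> * real c + \<sigma> * (real b + real c) * drawn_red (Suc n) \<omega>)
      \<in> borel_measurable (past M red (Suc n))"
    by measurable
  then show ?case
    by (rule measurable_cong[THEN iffD2, rotated]) (simp add: Z_Suc)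
qed

lemma Z_measurable [measurable]: "Z n \<in> borel_measurable M"
  by (rule measurable_from_subalg[OF subalgebra_past Z_past])

lemma U_measurable [measurable]: "U n \<in> borel_measurable M"
proof -
  have "(\<lambda>\<omega>. (real n + t) *\<^sub>R v\<^sub>1 + Z n \<omega> *\<^sub>R v\<^sub>2) \<in> borel_measurable M"
    by measurable
  then show ?thesis
    by (rule measurable_cong[THEN iffD2, rotated]) (simp add: U_eq)
qed

lemma drawn_red_square: "(drawn_red n \<omega>)\<^sup>2 = drawn_red n \<omega>"
  by (simp add: drawn_red_def)

text \<open>Each draw changes \<open>Z\<close> by at most
  \<open>\<bar>\<sigma>\<bar> * (b + c)\<close>. This deterministic bound makes all powers of
  \<open>Z n\<close> integrable and later supplies the dominating constants.\<close>

lemma Z_bound: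
  assumes "\<omega> \<in> space M"
  shows "\<bar>Z n \<omega>\<bar> \<le> \<bar>z\<^sub>0\<bar> + real n * (\<bar>\<sigma>\<bar> * (real b + real c))"
proof (induction n)
  case 0
  then show ?case using assms by (simp add: Z_0)
next
  case (Suc n)
  have "Z (Suc n) \<omega> = Z n \<omega> + \<sigma> * ((real b + real c) * drawn_red (Suc n) \<omega> - real c)"
    by (simp add: Z_Suc[OF assms] algebra_simps)
  also have "\<bar>\<dots>\<bar> \<le> \<bar>Z n \<omega>\<bar> + \<bar>\<sigma>\<bar> * \<bar>(real b + real c) * drawn_red (Suc n) \<omega> - real c\<bar>"
    by (metis abs_mult abs_triangle_ineq)
  also have "\<bar>\<sigma>\<bar> * \<bar>(real b + real c) * drawn_red (Suc n) \<omega> - real c\<bar> \<le> \<bar>\<sigma>\<bar> * (real b + real c)"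
    by (cases "red (Suc n) \<omega>") (simp_all add: drawn_red_def mult_left_mono)
  finally show ?case
    using Suc by (simp add: algebra_simps)
qed

lemma integrable_Z_power: "integrable M (\<lambda>\<omega>. Z n \<omega> ^ k)"
proof (rule integrable_const_bound)
  show "AE \<omega> in M. norm (Z n \<omega> ^ k) \<le> (\<bar>z\<^sub>0\<bar> + real n * (\<bar>\<sigma>\<bar> * (real b + real c))) ^ k"
    using Z_bound by (intro AE_I2) (simp add: power_abs power_mono)
qed simp

lemma integrable_Z [simp]: "integrable M (Z n)"
  using integrable_Z_power[of n 1] by simp

lemma integrable_drawn_red [simp]: "integrable M (drawn_red (Suc n))"
  by (rule integrable_const_bound[where B = 1]) (simp_all add: drawn_red_def)

lemma integrable_Z_drawn_red: "integrable M (\<lambda>\<omega>. Z n \<omega> ^ k * drawn_red (Suc n) \<omega>)"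
  by (rule Bochner_Integration.integrable_bound[OF integrable_Z_power[of n k]])
     (simp, simp add: drawn_red_def)

section \<open>Moment recursions for \<open>Z\<close>\<close>

lemma drawn_red_cond_exp:
  "AE \<omega> in M. real_cond_exp M (past M red n) (drawn_red (Suc n)) \<omega>
    = (real c + Z n \<omega> / (real n + t)) / (real b + real c)"
  using uniform_draw[of n] AE_space
  by eventually_elim (simp add: red_share_eq drawn_red_def[abs_def])

text \<open>\<open>Z n ^ k\<close> is pulled out of the conditional expectation of the next draw.
  The cases \<open>k = 0\<close> and \<open>k = 1\<close> feed the recursions for the first and
  second moments.\<close>

lemma expectation_Z_drawn_red:
  "expectation (\<lambda>\<omega>. Z n \<omega> ^ k * drawn_red (Suc n) \<omega>)
    = (real c * expectation (\<lambda>\<omega>. Z n \<omega> ^ k) + expectation (\<lambda>\<omega>. Z n \<omega> ^ Suc k) / (real n + t))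
      / (real b + real c)"
proof -
  interpret F: finite_measure_subalgebra M "past M red n"
    by unfold_locales (rule subalgebra_past)
  have "expectation (\<lambda>\<omega>. Z n \<omega> ^ k * drawn_red (Suc n) \<omega>)
      = expectation (\<lambda>\<omega>. Z n \<omega> ^ k * real_cond_exp M (past M red n) (drawn_red (Suc n)) \<omega>)"
    using Z_past by (intro F.real_cond_exp_intg(2)[symmetric] integrable_Z_drawn_red) simp_all
  also have "\<dots> = expectation (\<lambda>\<omega>. (real c * Z n \<omega> ^ k + Z n \<omega> ^ Suc k / (real n + t)) / (real b + real c))"
  proof (rule integral_cong_AE)
    show "AE \<omega> in M. Z n \<omega> ^ k * real_cond_exp M (past M red n) (drawn_red (Suc n)) \<omega>
        = (real c * Z n \<omega> ^ k + Z n \<omega> ^ Suc k / (real n + t)) / (real b + real c)"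
      using drawn_red_cond_exp[of n] by eventually_elim (simp add: algebra_simps)
  qed simp_all
  also have "\<dots> = (real c * expectation (\<lambda>\<omega>. Z n \<omega> ^ k) + expectation (\<lambda>\<omega>. Z n \<omega> ^ Suc k) / (real n + t))
      / (real b + real c)"
    using integrable_Z_power[of n k] integrable_Z_power[of n "Suc k"] by simp
  finally show ?thesis .
qed

text \<open>The drift \<open>- \<sigma> * c\<close> cancels against the constant part of the
  probability of red, so each step multiplies the mean by
  \<open>1 + \<sigma> / (n + t)\<close>.\<close>

lemma expectation_Z: "expectation (Z n) = growth t \<sigma> n * z\<^sub>0"
proof (induction n)
  case 0
  have "expectation (Z 0) = expectation (\<lambda>_. z\<^sub>0)"
    by (rule Bochner_Integration.integral_cong) (simp_all add: Z_0)
  then show ?case by (simp add: prob_space)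
next
  case (Suc n)
  have "expectation (Z (Suc n))
      = expectation (\<lambda>\<omega>. Z n \<omega> - \<sigma> * real c + \<sigma> * (real b + real c) * drawn_red (Suc n) \<omega>)"
    by (rule Bochner_Integration.integral_cong) (simp_all add: Z_Suc)
  also have "\<dots> = expectation (Z n) - \<sigma> * real c + \<sigma> * (real b + real c) * expectation (drawn_red (Suc n))"
    by (simp add: prob_space)
  also have "expectation (drawn_red (Suc n)) = (real c + expectation (Z n) / (real n + t)) / (real b + real c)"
    using expectation_Z_drawn_red[of n 0] by (simp add: prob_space)
  also have "expectation (Z n) - \<sigma> * real c
        + \<sigma> * (real b + real c) * ((real c + expectation (Z n) / (real n + t)) / (real b + real c))
      = expectation (Z n) * ((real n + t + \<sigma>) / (real n + t))"
  proof -
    define p N where "p = real b + real c" and "N = real n + t"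
    have "p \<noteq> 0" "N \<noteq> 0"
      using bc_pos t_pos by (simp_all add: p_def N_def add_nonneg_pos less_imp_neq[symmetric])
    then show ?thesis
      unfolding p_def[symmetric] N_def[symmetric] by (simp add: field_simps)
  qed
  finally show ?case
    using Suc by (simp add: growth_Suc)
qed

text \<open>The square of an indicator is the indicator itself, so the square of
  \<open>Z (Suc n)\<close> is affine in the draw and no moment of \<open>Z n\<close> above the
  second appears.\<close>

lemma expectation_Z_square_Suc:
  "expectation (\<lambda>\<omega>. (Z (Suc n) \<omega>)\<^sup>2)
    = expectation (\<lambda>\<omega>. (Z n \<omega>)\<^sup>2) * ((real n + t + 2 * \<sigma>) / (real n + t))
      + \<sigma>\<^sup>2 * (real b - real c) * expectation (Z n) / (real n + t) + \<sigma>\<^sup>2 * (real b * real c)"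
proof -
  let ?p = "real b + real c"
  have sq: "(Z (Suc n) \<omega>)\<^sup>2 = (Z n \<omega>)\<^sup>2 - 2 * \<sigma> * real c * Z n \<omega> + (\<sigma> * real c)\<^sup>2
      + 2 * \<sigma> * ?p * (Z n \<omega> * drawn_red (Suc n) \<omega>)
      + \<sigma>\<^sup>2 * (?p\<^sup>2 - 2 * ?p * real c) * drawn_red (Suc n) \<omega>" if "\<omega> \<in> space M" for \<omega>
  proof -
    have "(Z (Suc n) \<omega>)\<^sup>2 = (Z n \<omega>)\<^sup>2 - 2 * \<sigma> * real c * Z n \<omega> + (\<sigma> * real c)\<^sup>2
      + 2 * \<sigma> * ?p * (Z n \<omega> * drawn_red (Suc n) \<omega>)
      + \<sigma>\<^sup>2 * (?p\<^sup>2 * (drawn_red (Suc n) \<omega>)\<^sup>2 - 2 * ?p * real c * drawn_red (Suc n) \<omega>)"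
      unfolding Z_Suc[OF that] by (simp add: power2_eq_square algebra_simps)
    then show ?thesis
      unfolding drawn_red_square by (simp add: algebra_simps)
  qed
  have "expectation (\<lambda>\<omega>. (Z (Suc n) \<omega>)\<^sup>2)
      = expectation (\<lambda>\<omega>. (Z n \<omega>)\<^sup>2 - 2 * \<sigma> * real c * Z n \<omega> + (\<sigma> * real c)\<^sup>2
        + 2 * \<sigma> * ?p * (Z n \<omega> * drawn_red (Suc n) \<omega>)
        + \<sigma>\<^sup>2 * (?p\<^sup>2 - 2 * ?p * real c) * drawn_red (Suc n) \<omega>)"
    by (rule Bochner_Integration.integral_cong) (simp_all add: sq)
  also have "\<dots> = expectation (\<lambda>\<omega>. (Z n \<omega>)\<^sup>2) - 2 * \<sigma> * real c * expectation (Z n) + (\<sigma> * real c)\<^sup>2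
        + 2 * \<sigma> * ?p * expectation (\<lambda>\<omega>. Z n \<omega> * drawn_red (Suc n) \<omega>)
        + \<sigma>\<^sup>2 * (?p\<^sup>2 - 2 * ?p * real c) * expectation (drawn_red (Suc n))"
    using integrable_Z_power[of n 2] integrable_Z_drawn_red[of n 1] by (simp add: prob_space)
  also have "expectation (drawn_red (Suc n)) = (real c + expectation (Z n) / (real n + t)) / ?p"
    using expectation_Z_drawn_red[of n 0] by (simp add: prob_space)
  also have "expectation (\<lambda>\<omega>. Z n \<omega> * drawn_red (Suc n) \<omega>)
      = (real c * expectation (Z n) + expectation (\<lambda>\<omega>. (Z n \<omega>)\<^sup>2) / (real n + t)) / ?p"
    using expectation_Z_drawn_red[of n 1] by (simp add: numeral_2_eq_2)
  also have "expectation (\<lambda>\<omega>. (Z n \<omega>)\<^sup>2) - 2 * \<sigma> * real c * expectation (Z n) + (\<sigma> * real c)\<^sup>2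
        + 2 * \<sigma> * ?p * ((real c * expectation (Z n) + expectation (\<lambda>\<omega>. (Z n \<omega>)\<^sup>2) / (real n + t)) / ?p)
        + \<sigma>\<^sup>2 * (?p\<^sup>2 - 2 * ?p * real c) * ((real c + expectation (Z n) / (real n + t)) / ?p)
      = expectation (\<lambda>\<omega>. (Z n \<omega>)\<^sup>2) * ((real n + t + 2 * \<sigma>) / (real n + t))
        + \<sigma>\<^sup>2 * (real b - real c) * expectation (Z n) / (real n + t) + \<sigma>\<^sup>2 * (real b * real c)"
  proof -
    define p N where "p = real b + real c" and "N = real n + t"
    have "p \<noteq> 0" "N \<noteq> 0"
      using bc_pos t_pos by (simp_all add: p_def N_def add_nonneg_pos less_imp_neq[symmetric])
    have b: "real b = p - real c"
      by (simp add: p_def)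
    show ?thesis
      unfolding p_def[symmetric] N_def[symmetric] b
      using \<open>p \<noteq> 0\<close> \<open>N \<noteq> 0\<close> by (simp add: field_simps power2_eq_square)
  qed
  finally show ?thesis .
qed


text \<open>The recursion for \<open>E (Z n)\<^sup>2\<close> is linear with inhomogeneous terms proportional to
  \<open>growth t \<sigma> n / (n + t)\<close> and to 1; multiples of \<open>growth t \<sigma> n\<close> and of \<open>n + t\<close> are particular
  solutions for these, and \<open>growth t (2 * \<sigma>) n\<close> solves the homogeneous recursion.\<close>

lemma expectation_Z_square:
  assumes "\<sigma> > 1 / 2"
  shows "expectation (\<lambda>\<omega>. (Z n \<omega>)\<^sup>2)
    = (z\<^sub>0\<^sup>2 + \<sigma> * (real b - real c) * z\<^sub>0 + \<sigma>\<^sup>2 * (real b * real c) / (2 * \<sigma> - 1) * t) * growth t (2 * \<sigma>) n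
      - \<sigma> * (real b - real c) * z\<^sub>0 * growth t \<sigma> n
      - \<sigma>\<^sup>2 * (real b * real c) / (2 * \<sigma> - 1) * (real n + t)"
proof -
  define B where "B = \<sigma> * (real b - real c) * z\<^sub>0"
  \<comment> \<open>Chosen so that \<open>- C * (n + t)\<close> reproduces the constant
    inhomogeneous term.\<close>
  define C where "C = \<sigma>\<^sup>2 * (real b * real c) / (2 * \<sigma> - 1)"
  \<comment> \<open>Fixed by the initial value: at time 0 the formula reads
    \<open>A - B - C * t\<close>, which must be \<open>z\<^sub>0\<^sup>2\<close>.\<close>
  define A where "A = z\<^sub>0\<^sup>2 + B + C * t"
  have C: "\<sigma>\<^sup>2 * (real b * real c) = C * (2 * \<sigma> - 1)"
    using assms by (simp add: C_def)
  have "expectation (\<lambda>\<omega>. (Z n \<omega>)\<^sup>2) = A * growth t (2 * \<sigma>) n - B * growth t \<sigma> n - C * (real n + t)"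
  proof (induction n)
    case 0
    have "expectation (\<lambda>\<omega>. (Z 0 \<omega>)\<^sup>2) = expectation (\<lambda>_. z\<^sub>0\<^sup>2)"
      by (rule Bochner_Integration.integral_cong) (simp_all add: Z_0)
    then show ?case by (simp add: prob_space A_def)
  next
    case (Suc n)
    define N where "N = real n + t"
    have N: "N \<noteq> 0"
      using t_pos by (simp add: N_def add_nonneg_pos less_imp_neq[symmetric])
    have "\<sigma>\<^sup>2 * (real b - real c) * expectation (Z n) / N = \<sigma> * B * growth t \<sigma> n / N"
      by (simp add: expectation_Z B_def power2_eq_square)
    then have "expectation (\<lambda>\<omega>. (Z (Suc n) \<omega>)\<^sup>2)
        = (A * growth t (2 * \<sigma>) n - B * growth t \<sigma> n - C * N) * ((N + 2 * \<sigma>) / N)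
          + \<sigma> * B * growth t \<sigma> n / N + C * (2 * \<sigma> - 1)"
      unfolding expectation_Z_square_Suc Suc C N_def by simp
    also have "\<dots> = A * (growth t (2 * \<sigma>) n * ((N + 2 * \<sigma>) / N)) - B * (growth t \<sigma> n * ((N + \<sigma>) / N)) - C * (N + 1)"
      using N by (simp add: field_simps)
    finally show ?case
      by (simp add: growth_Suc N_def add_ac)
  qed
  then show ?thesis
    by (simp add: A_def B_def C_def)
qed

section \<open>The normalised martingale and its limit\<close>

text \<open>Conditioning multiplies \<open>Z n\<close> by \<open>1 + \<sigma> / (n + t)\<close>,
  exactly the ratio of consecutive values of \<open>growth t \<sigma>\<close>. Positivity of
  \<open>\<sigma>\<close> keeps these values nonzero.\<close>

lemma Z_martingale:
  assumes "\<sigma> > 0"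
  shows "l2_martingale M (past M red) (\<lambda>n \<omega>. Z n \<omega> / growth t \<sigma> n)"
proof unfold_locales
  fix n
  show "subalgebra M (past M red n)" "subalgebra (past M red (Suc n)) (past M red n)"
    by (rule subalgebra_past subalgebra_past_Suc)+
  note [measurable] = Z_past
  show "(\<lambda>\<omega>. Z n \<omega> / growth t \<sigma> n) \<in> borel_measurable (past M red n)"
    by measurable
  show "integrable M (\<lambda>\<omega>. (Z n \<omega> / growth t \<sigma> n)\<^sup>2)"
    using integrable_Z_power[of n 2] by (simp add: power_divide)
  interpret F: finite_measure_subalgebra M "past M red n"
    by unfold_locales (rule subalgebra_past)
  define N g where "N = real n + t" and "g = growth t \<sigma> (Suc n)"
  define A where "A \<omega> = (Z n \<omega> - \<sigma> * real c) / g" for \<omega>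
  define k where "k = \<sigma> * (real b + real c) / g"
  have pos: "N > 0" "g > 0" "growth t \<sigma> n > 0" "N + \<sigma> > 0"
    using t_pos assms by (simp_all add: N_def g_def growth_pos add_nonneg_pos)
  have A_past [measurable]: "A \<in> borel_measurable (past M red n)"
    unfolding A_def by measurable
  have int: "integrable M A" "integrable M (\<lambda>\<omega>. k * drawn_red (Suc n) \<omega>)"
    unfolding A_def by simp_all
  have "AE \<omega> in M. real_cond_exp M (past M red n) (\<lambda>\<omega>. Z (Suc n) \<omega> / g) \<omega>
      = real_cond_exp M (past M red n) (\<lambda>\<omega>. A \<omega> + k * drawn_red (Suc n) \<omega>) \<omega>"
  proof (rule F.real_cond_exp_cong)
    show "AE \<omega> in M. Z (Suc n) \<omega> / g = A \<omega> + k * drawn_red (Suc n) \<omega>"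
      by (rule AE_I2) (simp add: Z_Suc A_def k_def add_divide_distrib)
  qed (use int in auto)
  then show "AE \<omega> in M. real_cond_exp M (past M red n) (\<lambda>\<omega>. Z (Suc n) \<omega> / growth t \<sigma> (Suc n)) \<omega>
      = Z n \<omega> / growth t \<sigma> n"
    using F.real_cond_exp_add[OF int] F.real_cond_exp_F_meas[OF int(1) A_past]
      F.real_cond_exp_cmult[OF integrable_drawn_red, of k n] drawn_red_cond_exp[of n]
    unfolding g_def[symmetric] N_def[symmetric]
  proof eventually_elim
    case (elim \<omega>)
    have "real_cond_exp M (past M red n) (\<lambda>\<omega>. Z (Suc n) \<omega> / g) \<omega>
        = A \<omega> + k * ((real c + Z n \<omega> / N) / (real b + real c))"
      using elim by simp
    also have "k * ((real c + Z n \<omega> / N) / (real b + real c)) = \<sigma> * (real c + Z n \<omega> / N) / g"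
      using bc_pos by (simp add: k_def)
    also have "A \<omega> + \<sigma> * (real c + Z n \<omega> / N) / g = Z n \<omega> * ((N + \<sigma>) / N) / g"
      using pos by (simp add: A_def field_simps)
    also have "\<dots> = Z n \<omega> / growth t \<sigma> n"
      using pos(1,3,4) by (simp add: g_def growth_Suc N_def[symmetric])
    finally show ?case .
  qed
qed

text \<open>\<open>Z n / n powr \<sigma>\<close> is the martingale times \<open>r n\<close>, and
  \<open>r n\<close> tends to \<open>g\<close>; hence \<open>W\<close> is \<open>g\<close> times the
  martingale limit. The martingale theorem applies because the second moment of \<open>Z n\<close>,
  divided by \<open>n powr (2 * \<sigma>)\<close>, converges.\<close>

theorem Z_limit:
  assumes "\<sigma> > 1 / 2"
  obtains W where "W \<in> borel_measurable M"
    "AE \<omega> in M. (\<lambda>n. Z n \<omega> / real n powr \<sigma>) \<longlonglongrightarrow> W \<omega>"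
    "integrable M (\<lambda>\<omega>. (W \<omega>)\<^sup>2)"
    "\<And>n. integrable M (\<lambda>\<omega>. (Z n \<omega> / real n powr \<sigma> - W \<omega>)\<^sup>2)"
    "(\<lambda>n. expectation (\<lambda>\<omega>. (Z n \<omega> / real n powr \<sigma> - W \<omega>)\<^sup>2)) \<longlonglongrightarrow> 0"
    "expectation W = Gamma t / Gamma (t + \<sigma>) * z\<^sub>0"
    "expectation (\<lambda>\<omega>. (W \<omega>)\<^sup>2) = Gamma t / Gamma (t + 2 * \<sigma>)
      * (z\<^sub>0\<^sup>2 + \<sigma> * (real b - real c) * z\<^sub>0 + \<sigma>\<^sup>2 * (real b * real c) / (2 * \<sigma> - 1) * t)"
proof -
  have \<sigma>_pos: "\<sigma> > 0"
    using assms by simp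
  define \<gamma> where "\<gamma> = growth t \<sigma>"
  define g where "g = Gamma t / Gamma (t + \<sigma>)"
  define B where "B = \<sigma> * (real b - real c) * z\<^sub>0"
  define C where "C = \<sigma>\<^sup>2 * (real b * real c) / (2 * \<sigma> - 1)"
  define A where "A = z\<^sub>0\<^sup>2 + B + C * t"
  define Q where "Q = Gamma t / Gamma (t + 2 * \<sigma>) * A"
  define r where "r n = \<gamma> n / real n powr \<sigma>" for n
  define N where "N n \<omega> = Z n \<omega> / \<gamma> n" for n \<omega>
  interpret N: l2_martingale M "past M red" N
    unfolding N_def \<gamma>_def by (rule Z_martingale[OF \<sigma>_pos])
  have \<gamma>_pos: "\<gamma> n > 0" for n
    using growth_pos[OF t_pos \<sigma>_pos] by (simp add: \<gamma>_def)
  have g_pos: "g > 0"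
    using t_pos \<sigma>_pos by (simp add: g_def Gamma_real_pos)
  have r: "r \<longlonglongrightarrow> g"
    unfolding r_def g_def \<gamma>_def by (rule growth_asymptotics[OF t_pos \<sigma>_pos])
  have second_moment: "(\<lambda>n. expectation (\<lambda>\<omega>. (Z n \<omega>)\<^sup>2) / real n powr (2 * \<sigma>)) \<longlonglongrightarrow> Q"
  proof -
    have "(\<lambda>n. real n powr (- \<sigma>)) \<longlonglongrightarrow> 0"
      using \<sigma>_pos by real_asymp
    \<comment> \<open>Here the urn has to be large: the linear term of the second moment is
      negligible because \<open>2 * \<sigma> > 1\<close>.\<close>
    moreover have "(\<lambda>n. (real n + t) / real n powr (2 * \<sigma>)) \<longlonglongrightarrow> 0"
      using assms by real_asymp
    ultimately have "(\<lambda>n. A * (growth t (2 * \<sigma>) n / real n powr (2 * \<sigma>)) - B * (r n * real n powr (- \<sigma>))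
        - C * ((real n + t) / real n powr (2 * \<sigma>)))
      \<longlonglongrightarrow> A * (Gamma t / Gamma (t + 2 * \<sigma>)) - B * (g * 0) - C * 0"
      using \<sigma>_pos by (intro tendsto_intros growth_asymptotics t_pos r) simp_all
    moreover have "A * (growth t (2 * \<sigma>) n / real n powr (2 * \<sigma>)) - B * (r n * real n powr (- \<sigma>))
        - C * ((real n + t) / real n powr (2 * \<sigma>)) = expectation (\<lambda>\<omega>. (Z n \<omega>)\<^sup>2) / real n powr (2 * \<sigma>)" for n
    proof -
      have "real n powr (2 * \<sigma>) = real n powr \<sigma> * real n powr \<sigma>"
        by (simp add: powr_add[symmetric])
      then have "r n * real n powr (- \<sigma>) = \<gamma> n / real n powr (2 * \<sigma>)"
        by (simp add: r_def powr_minus_divide)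
      then show ?thesis
        unfolding expectation_Z_square[OF assms] A_def B_def C_def \<gamma>_def
        by (simp add: diff_divide_distrib)
    qed
    ultimately show ?thesis
      by (simp add: Q_def mult_ac)
  qed
  have "(\<lambda>n. expectation (\<lambda>\<omega>. (N n \<omega>)\<^sup>2)) \<longlonglongrightarrow> Q / g\<^sup>2"
  proof (rule Lim_transform_eventually)
    \<comment> \<open>Dividing by \<open>(r n)\<^sup>2\<close> trades the normalisation by powers of
      \<open>n\<close> for that by \<open>\<gamma> n\<close>.\<close>
    show "(\<lambda>n. expectation (\<lambda>\<omega>. (Z n \<omega>)\<^sup>2) / real n powr (2 * \<sigma>) / (r n)\<^sup>2) \<longlonglongrightarrow> Q / g\<^sup>2"
      using g_pos by (intro tendsto_intros second_moment r) simp
    show "\<forall>\<^sub>F n in sequentially. expectation (\<lambda>\<omega>. (Z n \<omega>)\<^sup>2) / real n powr (2 * \<sigma>) / (r n)\<^sup>2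
        = expectation (\<lambda>\<omega>. (N n \<omega>)\<^sup>2)"
      using eventually_gt_at_top[of 0]
    proof eventually_elim
      case (elim n)
      have "real n powr (2 * \<sigma>) = (real n powr \<sigma>)\<^sup>2"
        by (simp add: power2_eq_square powr_add[symmetric])
      then show ?case
        using elim \<gamma>_pos[of n] by (simp add: r_def N_def power_divide)
    qed
  qed
  then obtain N' where N': "N' \<in> borel_measurable M" "AE \<omega> in M. (\<lambda>n. N n \<omega>) \<longlonglongrightarrow> N' \<omega>"
    "\<And>n. integrable M (\<lambda>\<omega>. (N n \<omega> - N' \<omega>)\<^sup>2)" "integrable M (\<lambda>\<omega>. (N' \<omega>)\<^sup>2)"
    "(\<lambda>n. expectation (\<lambda>\<omega>. (N n \<omega> - N' \<omega>)\<^sup>2)) \<longlonglongrightarrow> 0"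
    "expectation N' = expectation (N 0)" "expectation (\<lambda>\<omega>. (N' \<omega>)\<^sup>2) = Q / g\<^sup>2"
    by (rule N.convergence) (rule that)
  note [measurable] = N'(1)
  \<comment> \<open>Also true at \<open>n = 0\<close>, where \<open>0 powr \<sigma> = 0\<close> and
    division by zero make both sides 0.\<close>
  have Z_eq: "Z n \<omega> / real n powr \<sigma> = r n * N n \<omega>" for n \<omega>
    using \<gamma>_pos[of n] by (simp add: r_def N_def)
  \<comment> \<open>Separates the error of the martingale from that of its normalisation:
    \<open>r * N - g * N' = r * (N - N') + (r - g) * N'\<close>, and a squared sum is at most twice
    the sum of squares.\<close>
  have sq_le: "(Z n \<omega> / real n powr \<sigma> - g * N' \<omega>)\<^sup>2
      \<le> 2 * (r n)\<^sup>2 * (N n \<omega> - N' \<omega>)\<^sup>2 + 2 * (r n - g)\<^sup>2 * (N' \<omega>)\<^sup>2" for n \<omega>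
  proof -
    have "2 * (r n)\<^sup>2 * (N n \<omega> - N' \<omega>)\<^sup>2 + 2 * (r n - g)\<^sup>2 * (N' \<omega>)\<^sup>2
        - (r n * N n \<omega> - g * N' \<omega>)\<^sup>2 = (r n * (N n \<omega> - N' \<omega>) - (r n - g) * N' \<omega>)\<^sup>2"
      by (simp add: power2_eq_square algebra_simps)
    then show ?thesis
      unfolding Z_eq by (metis diff_ge_0_iff_ge zero_le_power2)
  qed
  have int: "integrable M (\<lambda>\<omega>. (Z n \<omega> / real n powr \<sigma> - g * N' \<omega>)\<^sup>2)" for n
    by (rule Bochner_Integration.integrable_bound[
          where f = "\<lambda>\<omega>. 2 * (r n)\<^sup>2 * (N n \<omega> - N' \<omega>)\<^sup>2 + 2 * (r n - g)\<^sup>2 * (N' \<omega>)\<^sup>2"])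
       (use N'(3,4) sq_le in auto)
  show thesis
  proof
    show "(\<lambda>\<omega>. g * N' \<omega>) \<in> borel_measurable M"
      by measurable
    show "AE \<omega> in M. (\<lambda>n. Z n \<omega> / real n powr \<sigma>) \<longlonglongrightarrow> g * N' \<omega>"
      using N'(2) unfolding Z_eq by eventually_elim (intro tendsto_intros r)
    show "integrable M (\<lambda>\<omega>. (g * N' \<omega>)\<^sup>2)"
      using N'(4) by (simp add: power_mult_distrib)
    show "integrable M (\<lambda>\<omega>. (Z n \<omega> / real n powr \<sigma> - g * N' \<omega>)\<^sup>2)" for n
      by (rule int)
    show "(\<lambda>n. expectation (\<lambda>\<omega>. (Z n \<omega> / real n powr \<sigma> - g * N' \<omega>)\<^sup>2)) \<longlonglongrightarrow> 0"
    proof (rule Lim_null_comparison[OF always_eventually])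
      have "(\<lambda>n. 2 * (r n)\<^sup>2 * expectation (\<lambda>\<omega>. (N n \<omega> - N' \<omega>)\<^sup>2)
          + 2 * (r n - g)\<^sup>2 * expectation (\<lambda>\<omega>. (N' \<omega>)\<^sup>2))
        \<longlonglongrightarrow> 2 * g\<^sup>2 * 0 + 2 * (g - g)\<^sup>2 * expectation (\<lambda>\<omega>. (N' \<omega>)\<^sup>2)"
        by (intro tendsto_intros r N'(5))
      then show "(\<lambda>n. 2 * (r n)\<^sup>2 * expectation (\<lambda>\<omega>. (N n \<omega> - N' \<omega>)\<^sup>2)
          + 2 * (r n - g)\<^sup>2 * expectation (\<lambda>\<omega>. (N' \<omega>)\<^sup>2)) \<longlonglongrightarrow> 0"
        by simp
      have "expectation (\<lambda>\<omega>. (Z n \<omega> / real n powr \<sigma> - g * N' \<omega>)\<^sup>2)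
          \<le> expectation (\<lambda>\<omega>. 2 * (r n)\<^sup>2 * (N n \<omega> - N' \<omega>)\<^sup>2 + 2 * (r n - g)\<^sup>2 * (N' \<omega>)\<^sup>2)" for n
        using N'(3,4) sq_le int by (intro integral_mono) simp_all
      then show "\<forall>n. norm (expectation (\<lambda>\<omega>. (Z n \<omega> / real n powr \<sigma> - g * N' \<omega>)\<^sup>2))
          \<le> 2 * (r n)\<^sup>2 * expectation (\<lambda>\<omega>. (N n \<omega> - N' \<omega>)\<^sup>2)
            + 2 * (r n - g)\<^sup>2 * expectation (\<lambda>\<omega>. (N' \<omega>)\<^sup>2)"
        using N'(3,4) by simp
    qed
    have "expectation (N 0) = z\<^sub>0"
      using expectation_Z[of 0] by (simp add: N_def[abs_def] \<gamma>_def)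
    then show "expectation (\<lambda>\<omega>. g * N' \<omega>) = Gamma t / Gamma (t + \<sigma>) * z\<^sub>0"
      using N'(6) by (simp add: g_def)
    show "expectation (\<lambda>\<omega>. (g * N' \<omega>)\<^sup>2) = Gamma t / Gamma (t + 2 * \<sigma>)
      * (z\<^sub>0\<^sup>2 + \<sigma> * (real b - real c) * z\<^sub>0 + \<sigma>\<^sup>2 * (real b * real c) / (2 * \<sigma> - 1) * t)"
      using N'(7) g_pos by (simp add: power_mult_distrib Q_def A_def B_def C_def)
  qed
qed

end

section \<open>From \<open>Z\<close> back to the composition \<open>U\<close>\<close>

context finite_measure
begin

lemma in_Lp_of_bounded:
  assumes "f \<in> borel_measurable M" "\<And>\<omega>. \<omega> \<in> space M \<Longrightarrow> norm (f \<omega>) \<le> K" "p \<ge> 0"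
  shows "in_Lp M p f"
  unfolding in_Lp_def
proof
  note [measurable] = assms(1)
  show "integrable M (\<lambda>\<omega>. norm (f \<omega>) powr p)"
    using assms by (intro integrable_const_bound[where B = "K powr p"]) (auto intro!: powr_mono2)
qed (rule assms)

end

context balanced_polya_urn
begin

lemma norm_U_diff_bound:
  assumes "\<omega> \<in> space M"
  shows "norm (U n \<omega> - real n *\<^sub>R v\<^sub>1)
    \<le> t * norm v\<^sub>1 + (\<bar>z\<^sub>0\<bar> + real n * (\<bar>\<sigma>\<bar> * (real b + real c))) * norm v\<^sub>2"
proof -
  have "U n \<omega> - real n *\<^sub>R v\<^sub>1 = t *\<^sub>R v\<^sub>1 + Z n \<omega> *\<^sub>R v\<^sub>2"
    by (simp add: U_eq[OF assms] algebra_simps)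
  also have "norm \<dots> \<le> t * norm v\<^sub>1 + \<bar>Z n \<omega>\<bar> * norm v\<^sub>2"
    using t_pos by (intro norm_triangle_le) simp
  finally show ?thesis
    using mult_right_mono[OF Z_bound[OF assms, of n] norm_ge_zero[of v\<^sub>2]] by linarith
qed

text \<open>The bound is uniform in \<open>n\<close> and \<open>\<omega>\<close>, as dominated
  convergence requires. Its last summand covers \<open>n = 0\<close>, where division by zero leaves
  only \<open>- v\<^sub>1\<close>.\<close>

lemma norm_scaled_U_diff_bound:
  assumes "\<omega> \<in> space M"
  shows "norm (U n \<omega> /\<^sub>R real n - v\<^sub>1)
    \<le> t * norm v\<^sub>1 + (\<bar>z\<^sub>0\<bar> + \<bar>\<sigma>\<bar> * (real b + real c)) * norm v\<^sub>2 + norm v\<^sub>1"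
proof (cases "n = 0")
  case True
  then show ?thesis
    using t_pos by simp
next
  case False
  then have n: "real n \<ge> 1" by simp
  let ?K = "t * norm v\<^sub>1 + (\<bar>z\<^sub>0\<bar> + \<bar>\<sigma>\<bar> * (real b + real c)) * norm v\<^sub>2"
  have "t * norm v\<^sub>1 + (\<bar>z\<^sub>0\<bar> + real n * (\<bar>\<sigma>\<bar> * (real b + real c))) * norm v\<^sub>2
      \<le> (real n * t) * norm v\<^sub>1 + (real n * \<bar>z\<^sub>0\<bar> + real n * (\<bar>\<sigma>\<bar> * (real b + real c))) * norm v\<^sub>2"
    using n t_pos by (intro add_mono mult_right_mono) (simp_all add: mult_le_cancel_right1)
  then have "norm (U n \<omega> - real n *\<^sub>R v\<^sub>1) \<le> real n * ?K"
    using norm_U_diff_bound[OF assms, of n] by (simp add: algebra_simps)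
  moreover have "U n \<omega> /\<^sub>R real n - v\<^sub>1 = (U n \<omega> - real n *\<^sub>R v\<^sub>1) /\<^sub>R real n"
    using n by (simp add: scaleR_diff_right)
  ultimately have "norm (U n \<omega> /\<^sub>R real n - v\<^sub>1) \<le> ?K"
    using n by (simp add: divide_inverse_commute[symmetric] pos_divide_le_eq mult.commute)
  then show ?thesis
    by (rule add_increasing2[OF norm_ge_zero])
qed

text \<open>The distance to \<open>v\<^sub>1\<close> is bounded by a constant, so dominated
  convergence upgrades the almost sure limit for every \<open>p\<close> at once.\<close>

lemma tendsto_Lp_scaled_U:
  assumes lim: "AE \<omega> in M. (\<lambda>n. U n \<omega> /\<^sub>R real n) \<longlonglongrightarrow> v\<^sub>1" and "p \<ge> 1"
  shows "tendsto_Lp M p (\<lambda>n \<omega>. U n \<omega> /\<^sub>R real n) (\<lambda>\<omega>. v\<^sub>1)"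
  unfolding tendsto_Lp_def
proof (intro conjI allI)
  define K where "K = t * norm v\<^sub>1 + (\<bar>z\<^sub>0\<bar> + \<bar>\<sigma>\<bar> * (real b + real c)) * norm v\<^sub>2 + norm v\<^sub>1"
  have bound: "norm (U n \<omega> /\<^sub>R real n - v\<^sub>1) \<le> K" if "\<omega> \<in> space M" for n \<omega>
    unfolding K_def by (rule norm_scaled_U_diff_bound[OF that])
  show "in_Lp M p (\<lambda>\<omega>. U n \<omega> /\<^sub>R real n)" for n
  proof (rule in_Lp_of_bounded)
    show "norm (U n \<omega> /\<^sub>R real n) \<le> K + norm v\<^sub>1" if "\<omega> \<in> space M" for \<omega>
      using bound[OF that, of n] norm_triangle_sub[of "U n \<omega> /\<^sub>R real n" v\<^sub>1] by linarith
  qed (use \<open>p \<ge> 1\<close> in simp_all)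
  show "in_Lp M p (\<lambda>\<omega>. v\<^sub>1)"
    by (simp add: in_Lp_def)
  have "(\<lambda>n. \<integral>\<omega>. norm (U n \<omega> /\<^sub>R real n - v\<^sub>1) powr p \<partial>M) \<longlonglongrightarrow> (\<integral>\<omega>. 0 \<partial>M)"
  proof (rule integral_dominated_convergence)
    show "integrable M (\<lambda>_. K powr p)"
      by simp
    show "AE \<omega> in M. (\<lambda>n. norm (U n \<omega> /\<^sub>R real n - v\<^sub>1) powr p) \<longlonglongrightarrow> 0"
      using lim
    proof eventually_elim
      case (elim \<omega>)
      then have "(\<lambda>n. norm (U n \<omega> /\<^sub>R real n - v\<^sub>1)) \<longlonglongrightarrow> 0"
        by (simp add: LIM_zero_iff tendsto_norm_zero)
      then show ?case
        using \<open>p \<ge> 1\<close> by (intro tendsto_zero_powrI[OF _ tendsto_const]) auto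
    qed
    show "AE \<omega> in M. norm (norm (U n \<omega> /\<^sub>R real n - v\<^sub>1) powr p) \<le> K powr p" for n
      using bound \<open>p \<ge> 1\<close> by (intro AE_I2) (simp add: powr_mono2)
  qed simp_all
  then show "(\<lambda>n. \<integral>\<omega>. norm (U n \<omega> /\<^sub>R real n - v\<^sub>1) powr p \<partial>M) \<longlonglongrightarrow> 0"
    by simp
qed

text \<open>Isolates the deterministic offset caused by \<open>t\<close>, which vanishes in the
  limit for positive \<open>\<sigma>\<close>. At \<open>n = 0\<close> both sides are 0 by the
  conventions for \<open>powr\<close> and division.\<close>

lemma fluctuation_eq:
  assumes "\<omega> \<in> space M"
  shows "(U n \<omega> - real n *\<^sub>R v\<^sub>1) /\<^sub>R (real n powr \<sigma>)
    = (t * real n powr - \<sigma>) *\<^sub>R v\<^sub>1 + (Z n \<omega> / real n powr \<sigma>) *\<^sub>R v\<^sub>2"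
  by (simp add: U_eq[OF assms] powr_minus divide_inverse algebra_simps)

lemma tendsto_fluctuation:
  assumes "\<omega> \<in> space M" "\<sigma> > 0" "(\<lambda>n. Z n \<omega> / real n powr \<sigma>) \<longlonglongrightarrow> w"
  shows "(\<lambda>n. (U n \<omega> - real n *\<^sub>R v\<^sub>1) /\<^sub>R (real n powr \<sigma>)) \<longlonglongrightarrow> w *\<^sub>R v\<^sub>2"
proof -
  have "(\<lambda>n. real n powr - \<sigma>) \<longlonglongrightarrow> 0"
    using \<open>\<sigma> > 0\<close> by real_asymp
  then have "(\<lambda>n. (t * real n powr - \<sigma>) *\<^sub>R v\<^sub>1 + (Z n \<omega> / real n powr \<sigma>) *\<^sub>R v\<^sub>2)
      \<longlonglongrightarrow> (t * 0) *\<^sub>R v\<^sub>1 + w *\<^sub>R v\<^sub>2"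
    by (intro tendsto_intros assms)
  then show ?thesis
    by (simp add: fluctuation_eq[OF assms(1)])
qed

text \<open>The law of large numbers as a corollary of the fluctuation limit: the deviation of
  \<open>U n / n\<close> from \<open>v\<^sub>1\<close> is the fluctuation times
  \<open>n powr (\<sigma> - 1)\<close>, and \<open>\<sigma> < 1\<close>.\<close>

lemma tendsto_scaled_U:
  assumes "(\<lambda>n. (U n \<omega> - real n *\<^sub>R v\<^sub>1) /\<^sub>R (real n powr \<sigma>)) \<longlonglongrightarrow> w"
  shows "(\<lambda>n. U n \<omega> /\<^sub>R real n) \<longlonglongrightarrow> v\<^sub>1"
proof (rule Lim_transform_eventually)
  have "(\<lambda>n. real n powr (\<sigma> - 1)) \<longlonglongrightarrow> 0"
    using \<sigma>_less_1 by real_asymp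
  then have "(\<lambda>n. v\<^sub>1 + real n powr (\<sigma> - 1) *\<^sub>R ((U n \<omega> - real n *\<^sub>R v\<^sub>1) /\<^sub>R (real n powr \<sigma>))) \<longlonglongrightarrow> v\<^sub>1 + 0 *\<^sub>R w"
    by (intro tendsto_intros assms)
  then show "(\<lambda>n. v\<^sub>1 + real n powr (\<sigma> - 1) *\<^sub>R ((U n \<omega> - real n *\<^sub>R v\<^sub>1) /\<^sub>R (real n powr \<sigma>))) \<longlonglongrightarrow> v\<^sub>1"
    by simp
  show "\<forall>\<^sub>F n in sequentially.
      v\<^sub>1 + real n powr (\<sigma> - 1) *\<^sub>R ((U n \<omega> - real n *\<^sub>R v\<^sub>1) /\<^sub>R (real n powr \<sigma>)) = U n \<omega> /\<^sub>R real n"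
    using eventually_gt_at_top[of 0]
  proof eventually_elim
    case (elim n)
    have "real n powr (\<sigma> - 1) * inverse (real n powr \<sigma>) = inverse (real n)"
      using elim by (simp add: powr_diff divide_inverse)
    then have "real n powr (\<sigma> - 1) *\<^sub>R ((U n \<omega> - real n *\<^sub>R v\<^sub>1) /\<^sub>R (real n powr \<sigma>))
        = (U n \<omega> - real n *\<^sub>R v\<^sub>1) /\<^sub>R real n"
      by (simp only: scaleR_scaleR)
    then show ?case
      using elim by (simp add: scaleR_diff_right)
  qed
qed

text \<open>The error is a deterministic null sequence times \<open>v\<^sub>1\<close> plus the
  scalar error of \<open>Z\<close> times \<open>v\<^sub>2\<close>; bounding the square of the sum by
  twice the sum of squares reduces the claim to \<open>lim\<close>.\<close>

lemma tendsto_Lp_fluctuation: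
  assumes "\<sigma> > 0" and [measurable]: "W \<in> borel_measurable M"
    and W: "integrable M (\<lambda>\<omega>. (W \<omega>)\<^sup>2)"
    and int: "\<And>n. integrable M (\<lambda>\<omega>. (Z n \<omega> / real n powr \<sigma> - W \<omega>)\<^sup>2)"
    and lim: "(\<lambda>n. expectation (\<lambda>\<omega>. (Z n \<omega> / real n powr \<sigma> - W \<omega>)\<^sup>2)) \<longlonglongrightarrow> 0"
  shows "tendsto_Lp M 2 (\<lambda>n \<omega>. (U n \<omega> - real n *\<^sub>R v\<^sub>1) /\<^sub>R (real n powr \<sigma>)) (\<lambda>\<omega>. W \<omega> *\<^sub>R v\<^sub>2)"
  unfolding tendsto_Lp_def
proof (intro conjI allI)
  let ?D = "\<lambda>n \<omega>. (U n \<omega> - real n *\<^sub>R v\<^sub>1) /\<^sub>R (real n powr \<sigma>)"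
  show "in_Lp M 2 (?D n)" for n
  proof (rule in_Lp_of_bounded)
    show "norm (?D n \<omega>) \<le> (t * norm v\<^sub>1 + (\<bar>z\<^sub>0\<bar> + real n * (\<bar>\<sigma>\<bar> * (real b + real c))) * norm v\<^sub>2) / real n powr \<sigma>"
      if "\<omega> \<in> space M" for \<omega>
      using norm_U_diff_bound[OF that, of n] by (simp add: divide_inverse mult.commute mult_left_mono)
  qed simp_all
  show "in_Lp M 2 (\<lambda>\<omega>. W \<omega> *\<^sub>R v\<^sub>2)"
    using W by (simp add: in_Lp_def power_mult_distrib)
  define q where "q n = t * real n powr - \<sigma>" for n
  let ?bound = "\<lambda>n \<omega>. 2 * (q n * norm v\<^sub>1)\<^sup>2 + 2 * (norm v\<^sub>2)\<^sup>2 * (Z n \<omega> / real n powr \<sigma> - W \<omega>)\<^sup>2"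
  have bound: "norm (?D n \<omega> - W \<omega> *\<^sub>R v\<^sub>2) powr 2 \<le> ?bound n \<omega>" if "\<omega> \<in> space M" for n \<omega>
  proof -
    let ?e = "Z n \<omega> / real n powr \<sigma> - W \<omega>"
    have "?D n \<omega> - W \<omega> *\<^sub>R v\<^sub>2 = q n *\<^sub>R v\<^sub>1 + ?e *\<^sub>R v\<^sub>2"
      by (simp add: fluctuation_eq[OF that] q_def scaleR_diff_left)
    also have "norm \<dots> \<le> \<bar>q n\<bar> * norm v\<^sub>1 + \<bar>?e\<bar> * norm v\<^sub>2"
      by (rule norm_triangle_le) simp
    finally have "(norm (?D n \<omega> - W \<omega> *\<^sub>R v\<^sub>2))\<^sup>2 \<le> (\<bar>q n\<bar> * norm v\<^sub>1 + \<bar>?e\<bar> * norm v\<^sub>2)\<^sup>2"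
      by (rule power_mono) simp
    also have "\<dots> \<le> 2 * (\<bar>q n\<bar> * norm v\<^sub>1)\<^sup>2 + 2 * (\<bar>?e\<bar> * norm v\<^sub>2)\<^sup>2"
      using sum_squares_bound[of "\<bar>q n\<bar> * norm v\<^sub>1" "\<bar>?e\<bar> * norm v\<^sub>2"] by (simp add: power2_sum)
    finally show ?thesis
      by (simp add: power_mult_distrib mult_ac)
  qed
  show "(\<lambda>n. \<integral>\<omega>. norm (?D n \<omega> - W \<omega> *\<^sub>R v\<^sub>2) powr 2 \<partial>M) \<longlonglongrightarrow> 0"
  proof (rule Lim_null_comparison[OF always_eventually])
    have "q \<longlonglongrightarrow> 0"
      unfolding q_def using \<open>\<sigma> > 0\<close> by real_asymp
    then have "(\<lambda>n. 2 * (q n * norm v\<^sub>1)\<^sup>2 + 2 * (norm v\<^sub>2)\<^sup>2 * expectation (\<lambda>\<omega>. (Z n \<omega> / real n powr \<sigma> - W \<omega>)\<^sup>2))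
        \<longlonglongrightarrow> 2 * (0 * norm v\<^sub>1)\<^sup>2 + 2 * (norm v\<^sub>2)\<^sup>2 * 0"
      by (intro tendsto_intros lim)
    then show "(\<lambda>n. 2 * (q n * norm v\<^sub>1)\<^sup>2 + 2 * (norm v\<^sub>2)\<^sup>2 * expectation (\<lambda>\<omega>. (Z n \<omega> / real n powr \<sigma> - W \<omega>)\<^sup>2))
        \<longlonglongrightarrow> 0"
      by simp
    have "(\<integral>\<omega>. norm (?D n \<omega> - W \<omega> *\<^sub>R v\<^sub>2) powr 2 \<partial>M) \<le> expectation (?bound n)" for n
      using bound int by (intro integral_mono') simp_all
    then show "\<forall>n. norm (\<integral>\<omega>. norm (?D n \<omega> - W \<omega> *\<^sub>R v\<^sub>2) powr 2 \<partial>M)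
        \<le> 2 * (q n * norm v\<^sub>1)\<^sup>2 + 2 * (norm v\<^sub>2)\<^sup>2 * expectation (\<lambda>\<omega>. (Z n \<omega> / real n powr \<sigma> - W \<omega>)\<^sup>2)"
      using int by (simp add: prob_space)
  qed
qed

end


theorem theorem3p11:
  fixes M :: "'w measure"
    and a b c d \<alpha> \<beta> \<tau> S :: nat
    and red :: "nat \<Rightarrow> 'w \<Rightarrow> bool"
    and U :: "nat \<Rightarrow> 'w \<Rightarrow> real^2"
    and m \<sigma> :: real
    and v1 v2 :: "real^2"
  assumes urn: "balanced_polya_urn M a b c d \<alpha> \<beta> red U"
    and \<tau>: "\<tau> = \<alpha> + \<beta>"
    and S: "S = a + b"
    and m: "m = real a - real c"
    and \<sigma>: "\<sigma> = m / S"
    and v1: "v1 = (real S / real (b + c)) *\<^sub>R vector [real c, real b]"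
    and v2: "v2 = (real S / real (b + c)) *\<^sub>R vector [1, -1]"
    and large: "\<sigma> > 1 / 2"
  shows "(AE \<omega> in M. (\<lambda>n. U n \<omega> /\<^sub>R real n) \<longlonglongrightarrow> v1)
    \<and> (\<forall>p\<ge>1. tendsto_Lp M p (\<lambda>n \<omega>. U n \<omega> /\<^sub>R real n) (\<lambda>\<omega>. v1))
    \<and> (\<exists>W. W \<in> borel_measurable M
        \<and> (AE \<omega> in M. (\<lambda>n. (U n \<omega> - real n *\<^sub>R v1) /\<^sub>R (real n powr \<sigma>)) \<longlonglongrightarrow> W \<omega> *\<^sub>R v2)
        \<and> tendsto_Lp M 2 (\<lambda>n \<omega>. (U n \<omega> - real n *\<^sub>R v1) /\<^sub>R (real n powr \<sigma>))
              (\<lambda>\<omega>. W \<omega> *\<^sub>R v2)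
        \<and> integrable M W
        \<and> integrable M (\<lambda>\<omega>. (W \<omega>)\<^sup>2)
        \<and> (\<integral>\<omega>. W \<omega> \<partial>M)
            = Gamma (\<tau> / S) / Gamma (\<tau> / S + \<sigma>)
              * ((real b * real \<alpha> - real c * real \<beta>) / S)
        \<and> (\<integral>\<omega>. (W \<omega>)\<^sup>2 \<partial>M)
            = \<sigma>\<^sup>2 * (Gamma (\<tau> / S) / Gamma (\<tau> / S + 2 * \<sigma>))
              * (real b * real c / (2 * \<sigma> - 1) * (\<tau> / S)
                 + (real b - real c) * ((real b * real \<alpha> - real c * real \<beta>) / (\<sigma> * S))
                 + (real b * real \<alpha> - real c * real \<beta>)\<^sup>2 / (\<sigma>\<^sup>2 * (real S)\<^sup>2)))"
proof -
  interpret urn: balanced_polya_urn M a b c d \<alpha> \<beta> red U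
    by (rule urn)
  \<comment> \<open>The following equations translate the parameters of the statement into the
    constants of the locale.\<close>
  have S_eq: "real S = urn.S"
    by (simp add: S urn.S_def)
  have \<sigma>_eq: "\<sigma> = urn.\<sigma>"
    by (simp add: \<sigma> m S_eq urn.\<sigma>_def)
  have t_eq: "real \<tau> / real S = urn.t"
    by (simp add: \<tau> S_eq urn.t_def)
  have z_eq: "(real b * real \<alpha> - real c * real \<beta>) / real S = urn.z\<^sub>0"
    by (simp add: S_eq urn.z\<^sub>0_def)
  have v1_eq: "v1 = urn.v\<^sub>1" and v2_eq: "v2 = urn.v\<^sub>2"
    by (simp_all add: v1 v2 S_eq urn.v\<^sub>1_def urn.v\<^sub>2_def)
  have large': "urn.\<sigma> > 1 / 2" and pos: "urn.\<sigma> > 0"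
    using large by (simp_all add: \<sigma>_eq)
  obtain W where W: "W \<in> borel_measurable M"
    "AE \<omega> in M. (\<lambda>n. urn.Z n \<omega> / real n powr urn.\<sigma>) \<longlonglongrightarrow> W \<omega>"
    "integrable M (\<lambda>\<omega>. (W \<omega>)\<^sup>2)"
    "\<And>n. integrable M (\<lambda>\<omega>. (urn.Z n \<omega> / real n powr urn.\<sigma> - W \<omega>)\<^sup>2)"
    "(\<lambda>n. urn.expectation (\<lambda>\<omega>. (urn.Z n \<omega> / real n powr urn.\<sigma> - W \<omega>)\<^sup>2)) \<longlonglongrightarrow> 0"
    "urn.expectation W = Gamma urn.t / Gamma (urn.t + urn.\<sigma>) * urn.z\<^sub>0"
    "urn.expectation (\<lambda>\<omega>. (W \<omega>)\<^sup>2) = Gamma urn.t / Gamma (urn.t + 2 * urn.\<sigma>)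
      * (urn.z\<^sub>0\<^sup>2 + urn.\<sigma> * (real b - real c) * urn.z\<^sub>0
        + urn.\<sigma>\<^sup>2 * (real b * real c) / (2 * urn.\<sigma> - 1) * urn.t)"
    by (rule urn.Z_limit[OF large']) (rule that)
  have fluct: "AE \<omega> in M. (\<lambda>n. (U n \<omega> - real n *\<^sub>R urn.v\<^sub>1) /\<^sub>R (real n powr urn.\<sigma>)) \<longlonglongrightarrow> W \<omega> *\<^sub>R urn.v\<^sub>2"
    using W(2) AE_space by eventually_elim (rule urn.tendsto_fluctuation[OF _ pos])
  \<comment> \<open>The first-order limit is read off from the fluctuation limit, path by
    path.\<close>
  then have scaled: "AE \<omega> in M. (\<lambda>n. U n \<omega> /\<^sub>R real n) \<longlonglongrightarrow> urn.v\<^sub>1"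
    by eventually_elim (rule urn.tendsto_scaled_U)
  have z_eq': "(real b * real \<alpha> - real c * real \<beta>) / (urn.\<sigma> * real S) = urn.z\<^sub>0 / urn.\<sigma>"
    "(real b * real \<alpha> - real c * real \<beta>)\<^sup>2 / (urn.\<sigma>\<^sup>2 * (real S)\<^sup>2) = urn.z\<^sub>0\<^sup>2 / urn.\<sigma>\<^sup>2"
    by (simp_all add: z_eq[symmetric] power_divide mult.commute)
  have second: "urn.expectation (\<lambda>\<omega>. (W \<omega>)\<^sup>2) = urn.\<sigma>\<^sup>2 * (Gamma urn.t / Gamma (urn.t + 2 * urn.\<sigma>))
      * (real b * real c / (2 * urn.\<sigma> - 1) * urn.t + (real b - real c) * (urn.z\<^sub>0 / urn.\<sigma>)
        + urn.z\<^sub>0\<^sup>2 / urn.\<sigma>\<^sup>2)"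
  proof -
    \<comment> \<open>Factoring out the nonzero \<open>\<sigma>\<^sup>2\<close> brings the bracket
      into the form of the statement.\<close>
    have "urn.z\<^sub>0\<^sup>2 + urn.\<sigma> * (real b - real c) * urn.z\<^sub>0 + urn.\<sigma>\<^sup>2 * (real b * real c) / (2 * urn.\<sigma> - 1) * urn.t
      = urn.\<sigma>\<^sup>2 * (real b * real c / (2 * urn.\<sigma> - 1) * urn.t + (real b - real c) * (urn.z\<^sub>0 / urn.\<sigma>)
        + urn.z\<^sub>0\<^sup>2 / urn.\<sigma>\<^sup>2)"
      using pos by (simp add: distrib_left power2_eq_square)
    then show ?thesis
      unfolding W(7) by (simp only: mult_ac)
  qed
  show ?thesis
    unfolding z_eq z_eq' v1_eq v2_eq t_eq \<sigma>_eq
    \<comment> \<open>Integrability of \<open>W\<close> comes from its square integrability, the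
      measure being finite.\<close>
    using scaled urn.tendsto_Lp_scaled_U[OF scaled] W(1,3,6) fluct second
      urn.tendsto_Lp_fluctuation[OF pos W(1,3-5)] urn.square_integrable_imp_integrable[OF W(1,3)]
    by (intro conjI exI[of _ W]) (blast | simp only:)+
qed

end
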